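(* Let $(J,V,\lambda^{JV}):L\times\widetilde{L}\dashv R\times\widetilde{R}\to\overline{L}\dashv\overline{R}$ be a 1-cell in $\mathbf{Adj}_R(\mathbf{Cat})$ such that $\overline{R}$ reflects isomorphisms. The following statements are equivalent: (i) $H(\lambda^{JV})$ is invertible, i.e. the 1-cell $(J,V,\lambda^{JV})$ is left Hopf in $\mathbf{Adj}_R(\mathbf{Cat})$; (ii) $H(\Phi(\lambda^{JV}))$ is invertible, i.e. the induced 1-cell $(J,\Phi(\lambda^{JV})):(\mathcal{C}\times\mathcal{P},RL\times\widetilde{R}\widetilde{L})\to(\mathcal{D},\overline{R}\,\overline{L})$ is left Hopf in $\mathbf{Mnd}(\mathbf{Cat})$.
   Context: All categories are small. A category name also denotes its identity functor; juxtaposition denotes composition and whiskering. $L\dashv R:\mathcal{C}\to\mathcal{X}$ means $L:\mathcal{C}\to\mathcal{X}$ is left adjoint to $R$, with unit $\eta^{RL}$ and counit $\varepsilon^{LR}$. Here $L\dashv R:\mathcal{C}\to\mathcal{X}$, $\widetilde{L}\dashv\widetilde{R}:\mathcal{P}\to\mathcal{Q}$, $\overline{L}\dashv\overline{R}:\mathcal{D}\to\mathcal{Y}$ are adjunctions. A 1-cell $(J,V,\lambda):(L_1\dashv R_1:\mathcal{C}_1\to\mathcal{X}_1)\to(\overline{L}\dashv\overline{R}:\mathcal{D}\to\mathcal{Y})$ in $\mathbf{Adj}_R(\mathbf{Cat})$ consists of functors $J:\mathcal{C}_1\to\mathcal{D}$, $V:\mathcal{X}_1\to\mathcal{Y}$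 and a natural transformation $\lambda:\overline{L}J\to VL_1$ whose mate $\rho=\overline{R}V\varepsilon^{L_1R_1}\circ\overline{R}\lambda R_1\circ\eta^{\overline{R}\,\overline{L}}JR_1:JR_1\to\overline{R}V$ is invertible. With $\varrho=\rho^{-1}$, define $\Phi(\lambda)=\varrho L_1\circ\overline{R}\lambda:\overline{R}\,\overline{L}J\to JR_1L_1$; then $(J,\Phi(\lambda))$ is a 1-cell in $\mathbf{Mnd}(\mathbf{Cat})$ from the monad induced by $L_1\dashv R_1$ to that induced by $\overline{L}\dashv\overline{R}$. (A 1-cell $(B,\psi):(\mathcal{A},S)\to(\mathcal{D},T)$ in $\mathbf{Mnd}(\mathbf{Cat})$ is a functor $B:\mathcal{A}\to\mathcal{D}$ with $\psi:TB\to BS$ satisfying $\psi\circ\mu^TB=B\mu^S\circ\psi S\circ T\psi$ and $\psi\circ\eta^TB=B\eta^S$.) For $(J,V,\lambda^{JV}):L\times\widetilde{L}\dashv R\times\widetilde{R}\to\overline{L}\dashv\overline{R}$, $H(\lambda^{JV})=V(L\times\varepsilon^{\widetilde{L}\widetilde{R}})\circ\lambda^{JV}(\mathcal{C}\times\widetilde{R}):\overline{L}J(\mathcal{C}\times\widetilde{R})\to V(L\times\mathcal{Q})$; the 1-cell is left Hopf in $\mathbf{Adj}_R(\mathbf{Cat})$ if $H(\lambda^{JV})$ is invertible. For a 1-cell $(J,\psi^J):(\mathcal{C}\times\mathcal{P},S\times E)\to(\mathcal{D},T)$ in $\mathbf{Mnd}(\mathbf{Cat})$, $H(\psi^J):TJ(\mathcal{C}\times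 U^E)\to J(S\times U^E)$ (functors $\mathcal{C}\times\mathcal{P}^E\to\mathcal{D}$, with $\mathcal{P}^E$ the Eilenberg–Moore category and $U^E$ its forgetful functor) has component $J(SC,k_M)\circ\psi^J_{(C,M)}$ at $(C,(M,k_M))$; the 1-cell is left Hopf in $\mathbf{Mnd}(\mathbf{Cat})$ if $H(\psi^J)$ is invertible. *)

theory Defs
  imports Main
begin

text \<open>
  Small categories are given by explicit carrier sets of objects and arrows. Everything outside the
  carriers is junk: functors and natural transformations are only constrained on the carriers, and
  equations between natural transformations are equations between components at carrier objects.
\<close>

record ('o, 'a) cat =
  Obj :: "'o set"
  Arr :: "'a set"
  Dom :: "'a \<Rightarrow> 'o"
  Cod :: "'a \<Rightarrow> 'o"
  Ide :: "'o \<Rightarrow> 'a"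
  Cmp :: "'a \<Rightarrow> 'a \<Rightarrow> 'a"  (infixr \<open>\<cdot>\<index>\<close> 70)

definition in_hom :: "('o, 'a) cat \<Rightarrow> 'a \<Rightarrow> 'o \<Rightarrow> 'o \<Rightarrow> bool"
  where "in_hom C f x y \<longleftrightarrow> f \<in> Arr C \<and> Dom C f = x \<and> Cod C f = y"

locale category =
  fixes C :: "('o, 'a) cat"
  assumes dom_obj: "f \<in> Arr C \<Longrightarrow> Dom C f \<in> Obj C"
    and cod_obj: "f \<in> Arr C \<Longrightarrow> Cod C f \<in> Obj C"
    and ide_hom: "x \<in> Obj C \<Longrightarrow> in_hom C (Ide C x) x x"
    and cmp_hom: "in_hom C f x y \<Longrightarrow> in_hom C g y z \<Longrightarrow> in_hom C (g \<cdot>\<^bsub>C\<^esub> f) x z"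
    and cmp_assoc: "in_hom C f w x \<Longrightarrow> in_hom C g x y \<Longrightarrow> in_hom C h y z
          \<Longrightarrow> (h \<cdot>\<^bsub>C\<^esub> g) \<cdot>\<^bsub>C\<^esub> f = h \<cdot>\<^bsub>C\<^esub> (g \<cdot>\<^bsub>C\<^esub> f)"
    and cmp_ide_left: "in_hom C f x y \<Longrightarrow> Ide C y \<cdot>\<^bsub>C\<^esub> f = f"
    and cmp_ide_right: "in_hom C f x y \<Longrightarrow> f \<cdot>\<^bsub>C\<^esub> Ide C x = f"

definition inverse_arrows :: "('o, 'a) cat \<Rightarrow> 'a \<Rightarrow> 'a \<Rightarrow> bool"
  where "inverse_arrows C f g \<longleftrightarrow>
    f \<in> Arr C \<and> in_hom C g (Cod C f) (Dom C f) \<and>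
    g \<cdot>\<^bsub>C\<^esub> f = Ide C (Dom C f) \<and> f \<cdot>\<^bsub>C\<^esub> g = Ide C (Cod C f)"

definition iso :: "('o, 'a) cat \<Rightarrow> 'a \<Rightarrow> bool"
  where "iso C f \<longleftrightarrow> (\<exists>g. inverse_arrows C f g)"

text \<open>The inverse is unique in a category, so the description is proper whenever \<^term>\<open>iso C f\<close>.\<close>

definition inv_arrow :: "('o, 'a) cat \<Rightarrow> 'a \<Rightarrow> 'a"
  where "inv_arrow C f = (THE g. inverse_arrows C f g)"

definition prod_cat :: "('o, 'a) cat \<Rightarrow> ('p, 'b) cat \<Rightarrow> ('o \<times> 'p, 'a \<times> 'b) cat"  (infixr \<open>\<times>\<^sub>C\<close> 75)
  where "C \<times>\<^sub>C D =
    \<lparr> Obj = Obj C \<times> Obj D,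
      Arr = Arr C \<times> Arr D,
      Dom = map_prod (Dom C) (Dom D),
      Cod = map_prod (Cod C) (Cod D),
      Ide = map_prod (Ide C) (Ide D),
      Cmp = (\<lambda>(g, g') (f, f'). (g \<cdot>\<^bsub>C\<^esub> f, g' \<cdot>\<^bsub>D\<^esub> f')) \<rparr>"


subsection \<open>Functors and natural transformations\<close>

record ('o, 'a, 'p, 'b) functr =
  omap :: "'o \<Rightarrow> 'p"
  amap :: "'a \<Rightarrow> 'b"

locale cat_functor = dom: category C + cod: category D
  for C :: "('o, 'a) cat" and D :: "('p, 'b) cat" +
  fixes F :: "('o, 'a, 'p, 'b) functr"
  assumes omap_obj: "x \<in> Obj C \<Longrightarrow> omap F x \<in> Obj D"
    and amap_hom: "in_hom C f x y \<Longrightarrow> in_hom D (amap F f) (omap F x) (omap F y)"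
    and amap_ide: "x \<in> Obj C \<Longrightarrow> amap F (Ide C x) = Ide D (omap F x)"
    and amap_cmp: "in_hom C f x y \<Longrightarrow> in_hom C g y z
          \<Longrightarrow> amap F (g \<cdot>\<^bsub>C\<^esub> f) = amap F g \<cdot>\<^bsub>D\<^esub> amap F f"

definition id_functor :: "('o, 'a, 'o, 'a) functr"  (\<open>1\<^sub>F\<close>)
  where "1\<^sub>F = \<lparr> omap = (\<lambda>x. x), amap = (\<lambda>f. f) \<rparr>"

definition comp_functor ::
  "('p, 'b, 'q, 'c) functr \<Rightarrow> ('o, 'a, 'p, 'b) functr \<Rightarrow> ('o, 'a, 'q, 'c) functr"  (infixl \<open>\<circ>\<^sub>F\<close> 70)
  where "G \<circ>\<^sub>F F = \<lparr> omap = omap G \<circ> omap F, amap = amap G \<circ> amap F \<rparr>"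

definition prod_functor ::
  "('o, 'a, 'p, 'b) functr \<Rightarrow> ('o', 'a', 'p', 'b') functr
    \<Rightarrow> ('o \<times> 'o', 'a \<times> 'a', 'p \<times> 'p', 'b \<times> 'b') functr"  (infixr \<open>\<times>\<^sub>f\<close> 75)
  where "F \<times>\<^sub>f G = \<lparr> omap = map_prod (omap F) (omap G), amap = map_prod (amap F) (amap G) \<rparr>"

definition reflects_isos :: "('o, 'a) cat \<Rightarrow> ('p, 'b) cat \<Rightarrow> ('o, 'a, 'p, 'b) functr \<Rightarrow> bool"
  where "reflects_isos C D F \<longleftrightarrow> (\<forall>f \<in> Arr C. iso D (amap F f) \<longrightarrow> iso C f)"

text \<open>A natural transformation is represented by its family of components.\<close>

locale nat_trans = source: cat_functor C D F + target: cat_functor C D G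
  for C :: "('o, 'a) cat" and D :: "('p, 'b) cat"
    and F G :: "('o, 'a, 'p, 'b) functr" +
  fixes t :: "'o \<Rightarrow> 'b"
  assumes component_hom: "x \<in> Obj C \<Longrightarrow> in_hom D (t x) (omap F x) (omap G x)"
    and naturality: "in_hom C f x y \<Longrightarrow> t y \<cdot>\<^bsub>D\<^esub> amap F f = amap G f \<cdot>\<^bsub>D\<^esub> t x"

definition vcomp :: "('p, 'b) cat \<Rightarrow> ('o \<Rightarrow> 'b) \<Rightarrow> ('o \<Rightarrow> 'b) \<Rightarrow> 'o \<Rightarrow> 'b"
  where "vcomp D t s = (\<lambda>x. t x \<cdot>\<^bsub>D\<^esub> s x)"

definition whisker_left :: "('p, 'b, 'q, 'c) functr \<Rightarrow> ('o \<Rightarrow> 'b) \<Rightarrow> 'o \<Rightarrow> 'c"  (infixr \<open>\<rhd>\<close> 72)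
  where "F \<rhd> t = (\<lambda>x. amap F (t x))"

definition whisker_right :: "('p \<Rightarrow> 'c) \<Rightarrow> ('o, 'a, 'p, 'b) functr \<Rightarrow> 'o \<Rightarrow> 'c"  (infixl \<open>\<lhd>\<close> 73)
  where "t \<lhd> F = (\<lambda>x. t (omap F x))"

definition id_nt :: "('p, 'b) cat \<Rightarrow> ('o, 'a, 'p, 'b) functr \<Rightarrow> 'o \<Rightarrow> 'b"
  where "id_nt D F = (\<lambda>x. Ide D (omap F x))"

definition prod_nt :: "('o \<Rightarrow> 'b) \<Rightarrow> ('o' \<Rightarrow> 'b') \<Rightarrow> 'o \<times> 'o' \<Rightarrow> 'b \<times> 'b'"  (infixr \<open>\<times>\<^sub>N\<close> 75)
  where "s \<times>\<^sub>N t = map_prod s t"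

definition eq_nt :: "('o, 'a) cat \<Rightarrow> ('o \<Rightarrow> 'b) \<Rightarrow> ('o \<Rightarrow> 'b) \<Rightarrow> bool"
  where "eq_nt C s t \<longleftrightarrow> (\<forall>x \<in> Obj C. s x = t x)"

definition invertible_nt ::
  "('o, 'a) cat \<Rightarrow> ('p, 'b) cat \<Rightarrow> ('o, 'a, 'p, 'b) functr \<Rightarrow> ('o, 'a, 'p, 'b) functr
    \<Rightarrow> ('o \<Rightarrow> 'b) \<Rightarrow> bool"
  where "invertible_nt C D F G t \<longleftrightarrow>
    nat_trans C D F G t \<and>
    (\<exists>s. nat_trans C D G F s \<and>
         eq_nt C (vcomp D s t) (id_nt D F) \<and> eq_nt C (vcomp D t s) (id_nt D G))"

definition inv_nt :: "('p, 'b) cat \<Rightarrow> ('o \<Rightarrow> 'b) \<Rightarrow> 'o \<Rightarrow> 'b"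
  where "inv_nt D t = (\<lambda>x. inv_arrow D (t x))"


subsection \<open>Adjunctions\<close>

text \<open>
  For \<open>L \<stileturn> R : C \<rightarrow> X\<close> the fields are \<open>C\<close>, \<open>X\<close>, the left adjoint \<open>L : C \<rightarrow> X\<close>, the right adjoint
  \<open>R : X \<rightarrow> C\<close>, the unit \<open>C \<rightarrow> R L\<close> and the counit \<open>L R \<rightarrow> X\<close>.
\<close>

record ('o, 'a, 'p, 'b) adj =
  src :: "('o, 'a) cat"
  tgt :: "('p, 'b) cat"
  ladj :: "('o, 'a, 'p, 'b) functr"
  radj :: "('p, 'b, 'o, 'a) functr"
  aunit :: "'o \<Rightarrow> 'a"
  acounit :: "'p \<Rightarrow> 'b"

locale adjunction =
  fixes A :: "('o, 'a, 'p, 'b) adj"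
  assumes ladj_functor: "cat_functor (src A) (tgt A) (ladj A)"
    and radj_functor: "cat_functor (tgt A) (src A) (radj A)"
    and unit_nt: "nat_trans (src A) (src A) 1\<^sub>F (radj A \<circ>\<^sub>F ladj A) (aunit A)"
    and counit_nt: "nat_trans (tgt A) (tgt A) (ladj A \<circ>\<^sub>F radj A) 1\<^sub>F (acounit A)"
    and triangle_left: "eq_nt (src A)
          (vcomp (tgt A) (acounit A \<lhd> ladj A) (ladj A \<rhd> aunit A)) (id_nt (tgt A) (ladj A))"
    and triangle_right: "eq_nt (tgt A)
          (vcomp (src A) (radj A \<rhd> acounit A) (aunit A \<lhd> radj A)) (id_nt (src A) (radj A))"

definition prod_adj :: "('o, 'a, 'p, 'b) adj \<Rightarrow> ('o', 'a', 'p', 'b') adj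
    \<Rightarrow> ('o \<times> 'o', 'a \<times> 'a', 'p \<times> 'p', 'b \<times> 'b') adj"  (infixr \<open>\<times>\<^sub>A\<close> 75)
  where "A \<times>\<^sub>A B =
    \<lparr> src = src A \<times>\<^sub>C src B,
      tgt = tgt A \<times>\<^sub>C tgt B,
      ladj = ladj A \<times>\<^sub>f ladj B,
      radj = radj A \<times>\<^sub>f radj B,
      aunit = aunit A \<times>\<^sub>N aunit B,
      acounit = acounit A \<times>\<^sub>N acounit B \<rparr>"

text \<open>The mate \<open>J R\<^sub>1 \<rightarrow> R V\<close> of \<open>lam : L J \<rightarrow> V L\<^sub>1\<close>, for \<open>A = (L\<^sub>1 \<stileturn> R\<^sub>1)\<close> and \<open>B = (L \<stileturn> R)\<close>.\<close>

definition mate ::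
  "('o, 'a, 'p, 'b) adj \<Rightarrow> ('o', 'a', 'p', 'b') adj \<Rightarrow> ('o, 'a, 'o', 'a') functr
    \<Rightarrow> ('p, 'b, 'p', 'b') functr \<Rightarrow> ('o \<Rightarrow> 'b') \<Rightarrow> 'p \<Rightarrow> 'a'"
  where "mate A B J V lam =
    vcomp (src B) ((radj B \<circ>\<^sub>F V) \<rhd> acounit A)
      (vcomp (src B) (radj B \<rhd> (lam \<lhd> radj A)) (aunit B \<lhd> (J \<circ>\<^sub>F radj A)))"

text \<open>1-cells \<open>(J, V, lam) : A \<rightarrow> B\<close> of \<open>Adj\<^sub>R(Cat)\<close>.\<close>

locale adjR_1cell = source: adjunction A + target: adjunction B
  for A :: "('o, 'a, 'p, 'b) adj" and B :: "('o', 'a', 'p', 'b') adj" +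
  fixes J :: "('o, 'a, 'o', 'a') functr"
    and V :: "('p, 'b, 'p', 'b') functr"
    and lam :: "'o \<Rightarrow> 'b'"
  assumes J_functor: "cat_functor (src A) (src B) J"
    and V_functor: "cat_functor (tgt A) (tgt B) V"
    and lam_nt: "nat_trans (src A) (tgt B) (ladj B \<circ>\<^sub>F J) (V \<circ>\<^sub>F ladj A) lam"
    and mate_invertible:
      "invertible_nt (tgt A) (src B) (J \<circ>\<^sub>F radj A) (radj B \<circ>\<^sub>F V) (mate A B J V lam)"

definition Phi ::
  "('o, 'a, 'p, 'b) adj \<Rightarrow> ('o', 'a', 'p', 'b') adj \<Rightarrow> ('o, 'a, 'o', 'a') functr
    \<Rightarrow> ('p, 'b, 'p', 'b') functr \<Rightarrow> ('o \<Rightarrow> 'b') \<Rightarrow> 'o \<Rightarrow> 'a'"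
  where "Phi A B J V lam =
    vcomp (src B) (inv_nt (src B) (mate A B J V lam) \<lhd> ladj A) (radj B \<rhd> lam)"

text \<open>The fusion transformation of a 1-cell \<open>(J, V, lam) : A \<times> B \<rightarrow> E\<close> of \<open>Adj\<^sub>R(Cat)\<close>.\<close>

definition H_adj ::
  "('o, 'a, 'p, 'b) adj \<Rightarrow> ('o', 'a', 'p', 'b') adj \<Rightarrow> ('d, 'e, 'y, 'z) adj
    \<Rightarrow> ('p \<times> 'p', 'b \<times> 'b', 'y, 'z) functr \<Rightarrow> ('o \<times> 'o' \<Rightarrow> 'z) \<Rightarrow> 'o \<times> 'p' \<Rightarrow> 'z"
  where "H_adj A B E V lam =
    vcomp (tgt E) (V \<rhd> (id_nt (tgt A) (ladj A) \<times>\<^sub>N acounit B))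
      (lam \<lhd> ((1\<^sub>F :: ('o, 'a, 'o, 'a) functr) \<times>\<^sub>f radj B))"

definition left_hopf_adjR ::
  "('o, 'a, 'p, 'b) adj \<Rightarrow> ('o', 'a', 'p', 'b') adj \<Rightarrow> ('d, 'e, 'y, 'z) adj
    \<Rightarrow> ('o \<times> 'o', 'a \<times> 'a', 'd, 'e) functr \<Rightarrow> ('p \<times> 'p', 'b \<times> 'b', 'y, 'z) functr
    \<Rightarrow> ('o \<times> 'o' \<Rightarrow> 'z) \<Rightarrow> bool"
  where "left_hopf_adjR A B E J V lam \<longleftrightarrow>
    adjR_1cell (A \<times>\<^sub>A B) E J V lam \<and>
    invertible_nt (src A \<times>\<^sub>C tgt B) (tgt E)
      (ladj E \<circ>\<^sub>F J \<circ>\<^sub>F (1\<^sub>F \<times>\<^sub>f radj B)) (V \<circ>\<^sub>F (ladj A \<times>\<^sub>f 1\<^sub>F))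
      (H_adj A B E V lam)"


subsection \<open>Monads\<close>

record ('o, 'a) mnd =
  base :: "('o, 'a) cat"
  endo :: "('o, 'a, 'o, 'a) functr"
  mult :: "'o \<Rightarrow> 'a"
  munit :: "'o \<Rightarrow> 'a"

locale monad =
  fixes T :: "('o, 'a) mnd"
  assumes endo_functor: "cat_functor (base T) (base T) (endo T)"
    and mult_nt: "nat_trans (base T) (base T) (endo T \<circ>\<^sub>F endo T) (endo T) (mult T)"
    and munit_nt: "nat_trans (base T) (base T) 1\<^sub>F (endo T) (munit T)"
    and mult_assoc: "eq_nt (base T)
          (vcomp (base T) (mult T) (endo T \<rhd> mult T)) (vcomp (base T) (mult T) (mult T \<lhd> endo T))"
    and mult_unit_left: "eq_nt (base T)
          (vcomp (base T) (mult T) (munit T \<lhd> endo T)) (id_nt (base T) (endo T))"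
    and mult_unit_right: "eq_nt (base T)
          (vcomp (base T) (mult T) (endo T \<rhd> munit T)) (id_nt (base T) (endo T))"

definition induced_monad :: "('o, 'a, 'p, 'b) adj \<Rightarrow> ('o, 'a) mnd"
  where "induced_monad A =
    \<lparr> base = src A,
      endo = radj A \<circ>\<^sub>F ladj A,
      mult = radj A \<rhd> (acounit A \<lhd> ladj A),
      munit = aunit A \<rparr>"

definition prod_monad :: "('o, 'a) mnd \<Rightarrow> ('o', 'a') mnd \<Rightarrow> ('o \<times> 'o', 'a \<times> 'a') mnd"
    (infixr \<open>\<times>\<^sub>M\<close> 75)
  where "S \<times>\<^sub>M E =
    \<lparr> base = base S \<times>\<^sub>C base E,
      endo = endo S \<times>\<^sub>f endo E,
      mult = mult S \<times>\<^sub>N mult E,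
      munit = munit S \<times>\<^sub>N munit E \<rparr>"

text \<open>1-cells \<open>(B, psi) : S \<rightarrow> T\<close> of \<open>Mnd(Cat)\<close>, with \<open>psi : T B \<rightarrow> B S\<close>.\<close>

locale mnd_1cell = source: monad S + target: monad T
  for S :: "('o, 'a) mnd" and T :: "('p, 'b) mnd" +
  fixes B :: "('o, 'a, 'p, 'b) functr"
    and psi :: "'o \<Rightarrow> 'b"
  assumes B_functor: "cat_functor (base S) (base T) B"
    and psi_nt: "nat_trans (base S) (base T) (endo T \<circ>\<^sub>F B) (B \<circ>\<^sub>F endo S) psi"
    and psi_mult: "eq_nt (base S)
          (vcomp (base T) psi (mult T \<lhd> B))
          (vcomp (base T) (B \<rhd> mult S) (vcomp (base T) (psi \<lhd> endo S) (endo T \<rhd> psi)))"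
    and psi_unit: "eq_nt (base S)
          (vcomp (base T) psi (munit T \<lhd> B)) (B \<rhd> munit S)"

definition em_algebra :: "('o, 'a) mnd \<Rightarrow> 'o \<times> 'a \<Rightarrow> bool"
  where "em_algebra E = (\<lambda>(M, k).
    M \<in> Obj (base E) \<and> in_hom (base E) k (omap (endo E) M) M \<and>
    k \<cdot>\<^bsub>base E\<^esub> mult E M = k \<cdot>\<^bsub>base E\<^esub> amap (endo E) k \<and>
    k \<cdot>\<^bsub>base E\<^esub> munit E M = Ide (base E) M)"

definition em_morphism :: "('o, 'a) mnd \<Rightarrow> 'o \<times> 'a \<Rightarrow> 'o \<times> 'a \<Rightarrow> 'a \<Rightarrow> bool"
  where "em_morphism E = (\<lambda>(M, k) (N, l) f.
    in_hom (base E) f M N \<and> f \<cdot>\<^bsub>base E\<^esub> k = l \<cdot>\<^bsub>base E\<^esub> amap (endo E) f)"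

text \<open>
  The Eilenberg--Moore category. Its arrows carry their source and target algebras, because an arrow
  of the base category does not determine them.
\<close>

definition em_cat :: "('o, 'a) mnd \<Rightarrow> ('o \<times> 'a, ('o \<times> 'a) \<times> ('o \<times> 'a) \<times> 'a) cat"
  where "em_cat E =
    \<lparr> Obj = {m. em_algebra E m},
      Arr = {(m, n, f). em_algebra E m \<and> em_algebra E n \<and> em_morphism E m n f},
      Dom = (\<lambda>(m, n, f). m),
      Cod = (\<lambda>(m, n, f). n),
      Ide = (\<lambda>m. (m, m, Ide (base E) (fst m))),
      Cmp = (\<lambda>(_, p, g) (m, _, f). (m, p, g \<cdot>\<^bsub>base E\<^esub> f)) \<rparr>"

definition em_forget :: "('o \<times> 'a, ('o \<times> 'a) \<times> ('o \<times> 'a) \<times> 'a, 'o, 'a) functr"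
  where "em_forget = \<lparr> omap = (\<lambda>(M, k). M), amap = (\<lambda>(m, n, f). f) \<rparr>"

text \<open>The fusion transformation of a 1-cell \<open>(J, psi) : S \<times> E \<rightarrow> T\<close> of \<open>Mnd(Cat)\<close>.\<close>

definition H_mnd ::
  "('o, 'a) mnd \<Rightarrow> ('d, 'e) mnd \<Rightarrow> ('o \<times> 'o', 'a \<times> 'a', 'd, 'e) functr
    \<Rightarrow> ('o \<times> 'o' \<Rightarrow> 'e) \<Rightarrow> 'o \<times> ('o' \<times> 'a') \<Rightarrow> 'e"
  where "H_mnd S T J psi = (\<lambda>(c, (M, k)).
    amap J (Ide (base S) (omap (endo S) c), k) \<cdot>\<^bsub>base T\<^esub> psi (c, M))"

definition left_hopf_mnd ::
  "('o, 'a) mnd \<Rightarrow> ('o', 'a') mnd \<Rightarrow> ('d, 'e) mnd \<Rightarrow> ('o \<times> 'o', 'a \<times> 'a', 'd, 'e) functr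
    \<Rightarrow> ('o \<times> 'o' \<Rightarrow> 'e) \<Rightarrow> bool"
  where "left_hopf_mnd S E T J psi \<longleftrightarrow>
    mnd_1cell (S \<times>\<^sub>M E) T J psi \<and>
    invertible_nt (base S \<times>\<^sub>C em_cat E) (base T)
      (endo T \<circ>\<^sub>F J \<circ>\<^sub>F (1\<^sub>F \<times>\<^sub>f em_forget)) (J \<circ>\<^sub>F (endo S \<times>\<^sub>f em_forget))
      (H_mnd S T J psi)"

end

theory Submission
  imports Defs
begin

text \<open>
  Write \<open>L \<stileturn> R\<close>, \<open>L' \<stileturn> R'\<close>, \<open>L\<^sub>B \<stileturn> R\<^sub>B\<close> for the three adjunctions, \<open>\<epsilon>'\<close> for the counit of \<open>L' \<stileturn> R'\<close>
  and \<open>\<rho>\<close> for the mate. By naturality of \<open>\<rho>\<close>, the fusion transformation of \<open>\<Phi>(\<lambda>)\<close> at \<open>c\<close> and the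
  algebra \<open>(R' q, R' \<epsilon>'\<^sub>q)\<close> is the composite of \<open>R\<^sub>B H(\<lambda>)\<close> at \<open>(c, q)\<close> with the inverse of \<open>\<rho>\<close> at
  \<open>(L c, q)\<close>. As \<open>R\<^sub>B\<close> reflects isomorphisms, \<open>H(\<lambda>)\<close> is thus invertible if and only if \<open>H(\<Phi>(\<lambda>))\<close> is
  invertible at the algebras of this form. These include the free algebras, and every algebra is a
  coequalizer of free ones that is split in the base category; hence invertibility at the free
  algebras implies invertibility at all algebras.
\<close>

section \<open>Categories and isomorphisms\<close>

context category
begin

lemma arr_ide [simp]: "x \<in> Obj C \<Longrightarrow> Ide C x \<in> Arr C"
  and dom_ide [simp]: "x \<in> Obj C \<Longrightarrow> Dom C (Ide C x) = x"
  and cod_ide [simp]: "x \<in> Obj C \<Longrightarrow> Cod C (Ide C x) = x"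
  using ide_hom by (auto simp: in_hom_def)

lemma obj_dom [simp]: "f \<in> Arr C \<Longrightarrow> Dom C f \<in> Obj C"
  and obj_cod [simp]: "f \<in> Arr C \<Longrightarrow> Cod C f \<in> Obj C"
  by (rule dom_obj, assumption) (rule cod_obj)

lemma
  assumes "f \<in> Arr C" "g \<in> Arr C" "Dom C g = Cod C f"
  shows arr_cmp [simp]: "g \<cdot>\<^bsub>C\<^esub> f \<in> Arr C"
    and dom_cmp [simp]: "Dom C (g \<cdot>\<^bsub>C\<^esub> f) = Dom C f"
    and cod_cmp [simp]: "Cod C (g \<cdot>\<^bsub>C\<^esub> f) = Cod C g"
  using cmp_hom[of f "Dom C f" "Cod C f" g "Cod C g"] assms by (auto simp: in_hom_def)

lemma assoc [simp]:
  assumes "f \<in> Arr C" "g \<in> Arr C" "h \<in> Arr C" "Dom C g = Cod C f" "Dom C h = Cod C g"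
  shows "(h \<cdot>\<^bsub>C\<^esub> g) \<cdot>\<^bsub>C\<^esub> f = h \<cdot>\<^bsub>C\<^esub> g \<cdot>\<^bsub>C\<^esub> f"
  using cmp_assoc[of f "Dom C f" "Cod C f" g "Cod C g" h "Cod C h"] assms by (auto simp: in_hom_def)

lemma ide_left [simp]: "f \<in> Arr C \<Longrightarrow> Cod C f = y \<Longrightarrow> Ide C y \<cdot>\<^bsub>C\<^esub> f = f"
  and ide_right [simp]: "f \<in> Arr C \<Longrightarrow> Dom C f = x \<Longrightarrow> f \<cdot>\<^bsub>C\<^esub> Ide C x = f"
  by (auto intro: cmp_ide_left cmp_ide_right simp: in_hom_def)

lemma cmp_reassoc:
  assumes "g \<cdot>\<^bsub>C\<^esub> f = g' \<cdot>\<^bsub>C\<^esub> f'"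
    and "f \<in> Arr C" "g \<in> Arr C" "Dom C g = Cod C f"
    and "f' \<in> Arr C" "g' \<in> Arr C" "Dom C g' = Cod C f'"
    and "e \<in> Arr C" "Cod C e = Dom C f"
  shows "g \<cdot>\<^bsub>C\<^esub> f \<cdot>\<^bsub>C\<^esub> e = g' \<cdot>\<^bsub>C\<^esub> f' \<cdot>\<^bsub>C\<^esub> e"
proof -
  have "Dom C f' = Dom C f"
    using assms by (metis dom_cmp)
  moreover have "(g \<cdot>\<^bsub>C\<^esub> f) \<cdot>\<^bsub>C\<^esub> e = (g' \<cdot>\<^bsub>C\<^esub> f') \<cdot>\<^bsub>C\<^esub> e"
    using assms(1) by simp
  ultimately show ?thesis
    using assms(2-) by simp
qed

lemma inverse_arrows_unique:
  assumes "inverse_arrows C f g" "inverse_arrows C f h"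
  shows "g = h"
proof -
  have "g = g \<cdot>\<^bsub>C\<^esub> f \<cdot>\<^bsub>C\<^esub> h"
    using assms by (simp add: inverse_arrows_def in_hom_def)
  also have "\<dots> = (g \<cdot>\<^bsub>C\<^esub> f) \<cdot>\<^bsub>C\<^esub> h"
    using assms by (intro assoc[symmetric]) (simp_all add: inverse_arrows_def in_hom_def)
  also have "\<dots> = h"
    using assms by (simp add: inverse_arrows_def in_hom_def del: assoc)
  finally show ?thesis .
qed

lemma inverse_arrows_inv_arrow: "iso C f \<Longrightarrow> inverse_arrows C f (inv_arrow C f)"
  unfolding inv_arrow_def iso_def by (metis inverse_arrows_unique theI)

lemma
  assumes "iso C f"
  shows iso_arr: "f \<in> Arr C"
    and inv_arrow_arr [simp]: "inv_arrow C f \<in> Arr C"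
    and inv_arrow_dom [simp]: "Dom C (inv_arrow C f) = Cod C f"
    and inv_arrow_cod [simp]: "Cod C (inv_arrow C f) = Dom C f"
    and inv_arrow_left: "inv_arrow C f \<cdot>\<^bsub>C\<^esub> f = Ide C (Dom C f)"
    and inv_arrow_right: "f \<cdot>\<^bsub>C\<^esub> inv_arrow C f = Ide C (Cod C f)"
  using inverse_arrows_inv_arrow[OF assms] by (auto simp: inverse_arrows_def in_hom_def)

lemma isoI:
  assumes "f \<in> Arr C" "g \<in> Arr C" "Dom C g = Cod C f" "Cod C g = Dom C f"
    and "g \<cdot>\<^bsub>C\<^esub> f = Ide C (Dom C f)" "f \<cdot>\<^bsub>C\<^esub> g = Ide C (Cod C f)"
  shows "iso C f"
  using assms by (auto simp: iso_def inverse_arrows_def in_hom_def)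

lemma iso_inv_arrow:
  assumes "iso C f"
  shows "iso C (inv_arrow C f)"
  by (rule isoI[of _ f]) (simp_all add: assms iso_arr inv_arrow_left inv_arrow_right)

lemma inv_arrow_cancel_left:
  assumes "iso C f" "g \<in> Arr C" "Cod C g = Dom C f"
  shows "inv_arrow C f \<cdot>\<^bsub>C\<^esub> f \<cdot>\<^bsub>C\<^esub> g = g"
proof -
  have "inv_arrow C f \<cdot>\<^bsub>C\<^esub> f \<cdot>\<^bsub>C\<^esub> g = (inv_arrow C f \<cdot>\<^bsub>C\<^esub> f) \<cdot>\<^bsub>C\<^esub> g"
    using assms by (simp add: iso_arr)
  then show ?thesis
    using assms by (simp add: inv_arrow_left del: assoc)
qed

lemma inv_arrow_cancel_right:
  assumes "iso C f" "g \<in> Arr C" "Cod C g = Cod C f"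
  shows "f \<cdot>\<^bsub>C\<^esub> inv_arrow C f \<cdot>\<^bsub>C\<^esub> g = g"
proof -
  have "f \<cdot>\<^bsub>C\<^esub> inv_arrow C f \<cdot>\<^bsub>C\<^esub> g = (f \<cdot>\<^bsub>C\<^esub> inv_arrow C f) \<cdot>\<^bsub>C\<^esub> g"
    using assms by (simp add: iso_arr)
  then show ?thesis
    using assms by (simp add: inv_arrow_right del: assoc)
qed

lemma iso_cancel_left:
  assumes "iso C f" "g \<in> Arr C" "h \<in> Arr C" "Cod C g = Dom C f" "Cod C h = Dom C f"
    and "f \<cdot>\<^bsub>C\<^esub> g = f \<cdot>\<^bsub>C\<^esub> h"
  shows "g = h"
  using assms by (metis inv_arrow_cancel_left)

lemma inv_arrow_square:
  assumes "h \<cdot>\<^bsub>C\<^esub> a = b \<cdot>\<^bsub>C\<^esub> k" "iso C h" "iso C k"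
    and "a \<in> Arr C" "b \<in> Arr C" "Cod C a = Dom C h" "Dom C a = Dom C k"
    and "Dom C b = Cod C k" "Cod C b = Cod C h"
  shows "inv_arrow C h \<cdot>\<^bsub>C\<^esub> b = a \<cdot>\<^bsub>C\<^esub> inv_arrow C k"
proof (rule iso_cancel_left)
  have "b = b \<cdot>\<^bsub>C\<^esub> k \<cdot>\<^bsub>C\<^esub> inv_arrow C k"
    using assms by (simp add: inv_arrow_right)
  also have "\<dots> = h \<cdot>\<^bsub>C\<^esub> a \<cdot>\<^bsub>C\<^esub> inv_arrow C k"
    by (rule cmp_reassoc[OF assms(1)[symmetric]]) (use assms in \<open>simp_all add: iso_arr\<close>)
  finally show "h \<cdot>\<^bsub>C\<^esub> inv_arrow C h \<cdot>\<^bsub>C\<^esub> b = h \<cdot>\<^bsub>C\<^esub> a \<cdot>\<^bsub>C\<^esub> inv_arrow C k"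
    using assms by (simp add: inv_arrow_cancel_right)
qed (use assms in simp_all)

lemma iso_cmp:
  assumes "iso C f" "iso C g" "Dom C g = Cod C f"
  shows "iso C (g \<cdot>\<^bsub>C\<^esub> f)"
  by (rule isoI[of _ "inv_arrow C f \<cdot>\<^bsub>C\<^esub> inv_arrow C g"])
    (use assms in \<open>simp_all add: iso_arr inv_arrow_cancel_left inv_arrow_cancel_right
        inv_arrow_left inv_arrow_right\<close>)

lemma iso_cmp_inv_iff:
  assumes "iso C f" "g \<in> Arr C" "Cod C g = Cod C f"
  shows "iso C (inv_arrow C f \<cdot>\<^bsub>C\<^esub> g) \<longleftrightarrow> iso C g"
proof
  assume "iso C (inv_arrow C f \<cdot>\<^bsub>C\<^esub> g)"
  then have "iso C (f \<cdot>\<^bsub>C\<^esub> inv_arrow C f \<cdot>\<^bsub>C\<^esub> g)"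
    by (rule iso_cmp) (use assms in \<open>simp_all add: iso_arr\<close>)
  then show "iso C g"
    using assms by (simp add: inv_arrow_cancel_right)
qed (use assms in \<open>auto intro!: iso_cmp iso_inv_arrow\<close>)

end

lemma prod_cat_simps [simp]:
  "Obj (C \<times>\<^sub>C D) = Obj C \<times> Obj D"
  "Arr (C \<times>\<^sub>C D) = Arr C \<times> Arr D"
  "Dom (C \<times>\<^sub>C D) = map_prod (Dom C) (Dom D)"
  "Cod (C \<times>\<^sub>C D) = map_prod (Cod C) (Cod D)"
  "Ide (C \<times>\<^sub>C D) = map_prod (Ide C) (Ide D)"
  "(g, g') \<cdot>\<^bsub>C \<times>\<^sub>C D\<^esub> (f, f') = (g \<cdot>\<^bsub>C\<^esub> f, g' \<cdot>\<^bsub>D\<^esub> f')"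
  by (simp_all add: prod_cat_def)

lemma category_prod_cat:
  assumes "category C" "category D"
  shows "category (C \<times>\<^sub>C D)"
proof -
  interpret C: category C by fact
  interpret D: category D by fact
  show ?thesis
    by unfold_locales (auto simp: in_hom_def)
qed


section \<open>Functors and natural transformations\<close>

lemma functor_simps [simp]:
  "omap 1\<^sub>F x = x" "amap 1\<^sub>F f = f"
  "omap (G \<circ>\<^sub>F F) x' = omap G (omap F x')" "amap (G \<circ>\<^sub>F F) f' = amap G (amap F f')"
  "omap (F \<times>\<^sub>f F') = map_prod (omap F) (omap F')"
  "amap (F \<times>\<^sub>f F') = map_prod (amap F) (amap F')"
  by (simp_all add: id_functor_def comp_functor_def prod_functor_def)

lemma transformation_simps [simp]:
  "vcomp D t s x = t x \<cdot>\<^bsub>D\<^esub> s x" "(F \<rhd> s) x = amap F (s x)" "(s' \<lhd> G) y = s' (omap G y)"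
  "id_nt D F' z = Ide D (omap F' z)" "(s \<times>\<^sub>N u) = map_prod s u" "inv_nt D t x = inv_arrow D (t x)"
  by (simp_all add: vcomp_def whisker_left_def whisker_right_def id_nt_def prod_nt_def inv_nt_def)

lemma functr_eqI:
  "(\<And>x. omap F x = omap G x) \<Longrightarrow> (\<And>f. amap F f = amap G f) \<Longrightarrow> F = (G :: ('o, 'a, 'p, 'b) functr)"
  by (cases F; cases G) (simp add: fun_eq_iff)

context cat_functor
begin

declare omap_obj [simp] amap_ide [simp]

lemma arr_amap [simp]: "f \<in> Arr C \<Longrightarrow> amap F f \<in> Arr D"
  and dom_amap [simp]: "f \<in> Arr C \<Longrightarrow> Dom D (amap F f) = omap F (Dom C f)"
  and cod_amap [simp]: "f \<in> Arr C \<Longrightarrow> Cod D (amap F f) = omap F (Cod C f)"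
  using amap_hom by (auto simp: in_hom_def)

lemma amap_comp:
  "f \<in> Arr C \<Longrightarrow> g \<in> Arr C \<Longrightarrow> Dom C g = Cod C f \<Longrightarrow> amap F (g \<cdot>\<^bsub>C\<^esub> f) = amap F g \<cdot>\<^bsub>D\<^esub> amap F f"
  using amap_cmp by (auto simp: in_hom_def)

lemma amap_square:
  assumes "g \<cdot>\<^bsub>C\<^esub> f = g' \<cdot>\<^bsub>C\<^esub> f'"
    and "f \<in> Arr C" "g \<in> Arr C" "Dom C g = Cod C f"
    and "f' \<in> Arr C" "g' \<in> Arr C" "Dom C g' = Cod C f'"
  shows "amap F g \<cdot>\<^bsub>D\<^esub> amap F f = amap F g' \<cdot>\<^bsub>D\<^esub> amap F f'"
  using assms by (metis amap_comp)

lemma iso_amap: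
  assumes "iso C f"
  shows "iso D (amap F f)"
  by (rule cod.isoI[of _ "amap F (inv_arrow C f)"])
    (use assms in \<open>simp_all add: dom.iso_arr dom.inv_arrow_left dom.inv_arrow_right
        flip: amap_comp\<close>)

end

lemma cat_functorI:
  assumes "category C" "category D"
    and "\<And>x. x \<in> Obj C \<Longrightarrow> omap F x \<in> Obj D"
    and "\<And>f. f \<in> Arr C \<Longrightarrow> amap F f \<in> Arr D \<and> Dom D (amap F f) = omap F (Dom C f)
          \<and> Cod D (amap F f) = omap F (Cod C f)"
    and "\<And>x. x \<in> Obj C \<Longrightarrow> amap F (Ide C x) = Ide D (omap F x)"
    and "\<And>f g. f \<in> Arr C \<Longrightarrow> g \<in> Arr C \<Longrightarrow> Dom C g = Cod C f
          \<Longrightarrow> amap F (g \<cdot>\<^bsub>C\<^esub> f) = amap F g \<cdot>\<^bsub>D\<^esub> amap F f"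
  shows "cat_functor C D F"
  using assms by (intro cat_functor.intro cat_functor_axioms.intro) (auto simp: in_hom_def)

lemma cat_functor_id: "category C \<Longrightarrow> cat_functor C C 1\<^sub>F"
  by (rule cat_functorI) simp_all

lemma cat_functor_comp:
  assumes "cat_functor C D F" "cat_functor D E G"
  shows "cat_functor C E (G \<circ>\<^sub>F F)"
proof -
  interpret F: cat_functor C D F by fact
  interpret G: cat_functor D E G by fact
  show ?thesis
    by (rule cat_functorI)
      (simp_all add: F.dom.category_axioms G.cod.category_axioms F.amap_comp G.amap_comp)
qed

lemma cat_functor_prod:
  assumes "cat_functor C D F" "cat_functor C' D' F'"
  shows "cat_functor (C \<times>\<^sub>C C') (D \<times>\<^sub>C D') (F \<times>\<^sub>f F')"
proof -
  interpret F: cat_functor C D F by fact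
  interpret F': cat_functor C' D' F' by fact
  show ?thesis
    by (rule cat_functorI)
      (auto simp: F.amap_comp F'.amap_comp
        intro!: category_prod_cat F.dom.category_axioms F'.dom.category_axioms
          F.cod.category_axioms F'.cod.category_axioms)
qed

context nat_trans
begin

lemma component_arr [simp]: "x \<in> Obj C \<Longrightarrow> t x \<in> Arr D"
  and component_dom [simp]: "x \<in> Obj C \<Longrightarrow> Dom D (t x) = omap F x"
  and component_cod [simp]: "x \<in> Obj C \<Longrightarrow> Cod D (t x) = omap G x"
  using component_hom by (auto simp: in_hom_def)

lemma natural:
  assumes "f \<in> Arr C" "Dom C f = x" "Cod C f = y"
  shows "t y \<cdot>\<^bsub>D\<^esub> amap F f = amap G f \<cdot>\<^bsub>D\<^esub> t x"
  using naturality assms by (auto simp: in_hom_def)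

end

lemma nat_transI:
  assumes "cat_functor C D F" "cat_functor C D G"
    and "\<And>x. x \<in> Obj C \<Longrightarrow> t x \<in> Arr D \<and> Dom D (t x) = omap F x \<and> Cod D (t x) = omap G x"
    and "\<And>f. f \<in> Arr C \<Longrightarrow> t (Cod C f) \<cdot>\<^bsub>D\<^esub> amap F f = amap G f \<cdot>\<^bsub>D\<^esub> t (Dom C f)"
  shows "nat_trans C D F G t"
  using assms by (intro nat_trans.intro nat_trans_axioms.intro) (auto simp: in_hom_def)

lemma nat_trans_vcomp:
  assumes "nat_trans C D F G s" "nat_trans C D G H t"
  shows "nat_trans C D F H (vcomp D t s)"
proof -
  interpret s: nat_trans C D F G s by fact
  interpret t: nat_trans C D G H t by fact
  show ?thesis
  proof (rule nat_transI)
    fix f assume f: "f \<in> Arr C"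
    let ?x = "Dom C f" and ?y = "Cod C f"
    have "t ?y \<cdot>\<^bsub>D\<^esub> s ?y \<cdot>\<^bsub>D\<^esub> amap F f = t ?y \<cdot>\<^bsub>D\<^esub> amap G f \<cdot>\<^bsub>D\<^esub> s ?x"
      using f by (simp add: s.natural)
    also have "\<dots> = amap H f \<cdot>\<^bsub>D\<^esub> t ?x \<cdot>\<^bsub>D\<^esub> s ?x"
      by (rule s.source.cod.cmp_reassoc[OF t.natural]) (use f in simp_all)
    finally show "vcomp D t s ?y \<cdot>\<^bsub>D\<^esub> amap F f = amap H f \<cdot>\<^bsub>D\<^esub> vcomp D t s ?x"
      using f by simp
  qed (simp_all add: s.source.cat_functor_axioms t.target.cat_functor_axioms)
qed

lemma nat_trans_whisker_left:
  assumes "nat_trans C D F G t" "cat_functor D E H"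
  shows "nat_trans C E (H \<circ>\<^sub>F F) (H \<circ>\<^sub>F G) (H \<rhd> t)"
proof -
  interpret t: nat_trans C D F G t by fact
  interpret H: cat_functor D E H by fact
  show ?thesis
    by (rule nat_transI)
      (simp_all add: t.natural cat_functor_comp[OF _ H.cat_functor_axioms]
        t.source.cat_functor_axioms t.target.cat_functor_axioms flip: H.amap_comp)
qed

lemma nat_trans_whisker_right:
  assumes "nat_trans D E F G t" "cat_functor C D H"
  shows "nat_trans C E (F \<circ>\<^sub>F H) (G \<circ>\<^sub>F H) (t \<lhd> H)"
proof -
  interpret t: nat_trans D E F G t by fact
  interpret H: cat_functor C D H by fact
  show ?thesis
    by (rule nat_transI)
      (simp_all add: t.natural cat_functor_comp[OF H.cat_functor_axioms]
        t.source.cat_functor_axioms t.target.cat_functor_axioms)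
qed

lemma nat_trans_id:
  assumes "cat_functor C D F"
  shows "nat_trans C D F F (id_nt D F)"
proof -
  interpret F: cat_functor C D F by fact
  show ?thesis
    by (rule nat_transI) (simp_all add: F.cat_functor_axioms)
qed

lemma nat_trans_prod:
  assumes "nat_trans C D F G t" "nat_trans C' D' F' G' t'"
  shows "nat_trans (C \<times>\<^sub>C C') (D \<times>\<^sub>C D') (F \<times>\<^sub>f F') (G \<times>\<^sub>f G') (t \<times>\<^sub>N t')"
proof -
  interpret t: nat_trans C D F G t by fact
  interpret t': nat_trans C' D' F' G' t' by fact
  show ?thesis
    by (rule nat_transI)
      (auto simp: t.natural t'.natural
        intro!: cat_functor_prod t.source.cat_functor_axioms t'.source.cat_functor_axioms
          t.target.cat_functor_axioms t'.target.cat_functor_axioms)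
qed

lemma invertible_nt_component_iso:
  assumes "invertible_nt C D F G t" "x \<in> Obj C"
  shows "iso D (t x)"
proof -
  obtain s where "nat_trans C D F G t" "nat_trans C D G F s"
    and s: "eq_nt C (vcomp D s t) (id_nt D F)" "eq_nt C (vcomp D t s) (id_nt D G)"
    using assms(1) by (auto simp: invertible_nt_def)
  interpret t: nat_trans C D F G t by fact
  interpret s: nat_trans C D G F s by fact
  show ?thesis
    by (rule t.source.cod.isoI[of _ "s x"]) (use assms(2) s in \<open>simp_all add: eq_nt_def\<close>)
qed

lemma nat_trans_inv_nt:
  assumes "nat_trans C D F G t" and iso: "\<And>x. x \<in> Obj C \<Longrightarrow> iso D (t x)"
  shows "nat_trans C D G F (inv_nt D t)"
proof -
  interpret t: nat_trans C D F G t by fact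
  show ?thesis
  proof (rule nat_transI)
    fix f assume f: "f \<in> Arr C"
    let ?x = "Dom C f" and ?y = "Cod C f"
    have "inv_arrow D (t ?y) \<cdot>\<^bsub>D\<^esub> amap G f = amap F f \<cdot>\<^bsub>D\<^esub> inv_arrow D (t ?x)"
      by (rule t.source.cod.inv_arrow_square[OF t.natural]) (use f iso in simp_all)
    then show "inv_nt D t ?y \<cdot>\<^bsub>D\<^esub> amap G f = amap F f \<cdot>\<^bsub>D\<^esub> inv_nt D t ?x"
      by simp
  qed (use iso in \<open>simp_all add: t.source.cat_functor_axioms t.target.cat_functor_axioms\<close>)
qed

lemma invertible_nt_iff:
  assumes "nat_trans C D F G t"
  shows "invertible_nt C D F G t \<longleftrightarrow> (\<forall>x \<in> Obj C. iso D (t x))"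
proof
  assume iso: "\<forall>x \<in> Obj C. iso D (t x)"
  interpret t: nat_trans C D F G t by fact
  have "nat_trans C D G F (inv_nt D t)"
    by (rule nat_trans_inv_nt[OF assms]) (use iso in blast)
  moreover have "eq_nt C (vcomp D (inv_nt D t) t) (id_nt D F)"
    "eq_nt C (vcomp D t (inv_nt D t)) (id_nt D G)"
    using iso by (simp_all add: eq_nt_def t.source.cod.inv_arrow_left t.source.cod.inv_arrow_right)
  ultimately show "invertible_nt C D F G t"
    using assms by (auto simp: invertible_nt_def)
qed (auto intro: invertible_nt_component_iso)

lemma comp_functor_assoc: "(H \<circ>\<^sub>F G) \<circ>\<^sub>F F = H \<circ>\<^sub>F (G \<circ>\<^sub>F F)"
  by (rule functr_eqI) simp_all

lemma comp_functor_id [simp]: "1\<^sub>F \<circ>\<^sub>F F = F" "F \<circ>\<^sub>F 1\<^sub>F = F"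
  by (rule functr_eqI; simp)+

lemma comp_functor_prod: "(F \<times>\<^sub>f F') \<circ>\<^sub>F (G \<times>\<^sub>f G') = (F \<circ>\<^sub>F G) \<times>\<^sub>f (F' \<circ>\<^sub>F G')"
  by (rule functr_eqI) (auto simp: fun_eq_iff)


section \<open>Eilenberg--Moore algebras\<close>

sublocale monad \<subseteq> endo: cat_functor "base T" "base T" "endo T"
  by (rule endo_functor)

sublocale monad \<subseteq> mult: nat_trans "base T" "base T" "endo T \<circ>\<^sub>F endo T" "endo T" "mult T"
  by (rule mult_nt)

sublocale monad \<subseteq> munit: nat_trans "base T" "base T" "1\<^sub>F" "endo T" "munit T"
  by (rule munit_nt)

lemma em_cat_simps [simp]:
  "x \<in> Obj (em_cat E) \<longleftrightarrow> em_algebra E x"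
  "(m, n, f) \<in> Arr (em_cat E) \<longleftrightarrow> em_algebra E m \<and> em_algebra E n \<and> em_morphism E m n f"
  "Dom (em_cat E) (m, n, f) = m" "Cod (em_cat E) (m, n, f) = n"
  "Ide (em_cat E) m = (m, m, Ide (base E) (fst m))"
  "(n', p, g) \<cdot>\<^bsub>em_cat E\<^esub> (m, n, f) = (m, p, g \<cdot>\<^bsub>base E\<^esub> f)"
  by (simp_all add: em_cat_def)

lemma em_forget_simps [simp]:
  "omap em_forget m = fst m" "amap em_forget (m, n, f) = f"
  by (simp_all add: em_forget_def split_beta)

context monad
begin

abbreviation free_algebra :: "'o \<Rightarrow> 'o \<times> 'a"
  where "free_algebra p \<equiv> (omap (endo T) p, mult T p)"

lemma em_algebra_free: "p \<in> Obj (base T) \<Longrightarrow> em_algebra T (free_algebra p)"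
  using mult_assoc mult_unit_left by (simp add: em_algebra_def in_hom_def eq_nt_def)

lemma em_morphism_ide: "em_algebra T m \<Longrightarrow> em_morphism T m m (Ide (base T) (fst m))"
  by (auto simp: em_algebra_def em_morphism_def in_hom_def)

lemma em_morphism_cmp:
  assumes "em_algebra T (M, k)" "em_algebra T (N, l)" "em_algebra T (P, j)"
    and "em_morphism T (M, k) (N, l) f" "em_morphism T (N, l) (P, j) g"
  shows "em_morphism T (M, k) (P, j) (g \<cdot>\<^bsub>base T\<^esub> f)"
proof -
  note [simp] = assms[unfolded em_algebra_def em_morphism_def in_hom_def, simplified]
  have "g \<cdot>\<^bsub>base T\<^esub> f \<cdot>\<^bsub>base T\<^esub> k = g \<cdot>\<^bsub>base T\<^esub> l \<cdot>\<^bsub>base T\<^esub> amap (endo T) f"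
    by simp
  also have "\<dots> = j \<cdot>\<^bsub>base T\<^esub> amap (endo T) g \<cdot>\<^bsub>base T\<^esub> amap (endo T) f"
    by (rule endo.dom.cmp_reassoc) simp_all
  finally show ?thesis
    by (simp add: em_morphism_def in_hom_def endo.amap_comp)
qed

lemma category_em_cat: "category (em_cat T)"
proof unfold_locales
  fix f x y g z
  assume "in_hom (em_cat T) f x y" "in_hom (em_cat T) g y z"
  then show "in_hom (em_cat T) (g \<cdot>\<^bsub>em_cat T\<^esub> f) x z"
    by (cases f; cases g; cases x; cases y; cases z) (auto simp: in_hom_def intro: em_morphism_cmp)
qed (auto simp: in_hom_def em_morphism_ide; auto simp: em_morphism_def in_hom_def)+

lemma cat_functor_em_forget: "cat_functor (em_cat T) (base T) em_forget"
  by (rule cat_functorI)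
    (auto simp: category_em_cat endo.dom.category_axioms em_algebra_def em_morphism_def in_hom_def)

lemma nat_trans_em_action:
  "nat_trans (em_cat T) (base T) (endo T \<circ>\<^sub>F em_forget) em_forget snd"
  by (rule nat_transI)
    (auto simp: cat_functor_em_forget cat_functor_comp[OF cat_functor_em_forget endo_functor]
      em_algebra_def em_morphism_def in_hom_def)

text \<open>Every algebra \<open>(M, k)\<close> is a coequalizer of free algebras that is split in the base category.
  As \<open>F\<close> and \<open>G\<close> are defined on the base category, they preserve it, so that \<open>h\<close> is invertible
  at \<open>(M, k)\<close> if it is invertible at the free algebras.\<close>

lemma iso_component_if_iso_free:
  assumes nt: "nat_trans (em_cat T) D (F \<circ>\<^sub>F em_forget) (G \<circ>\<^sub>F em_forget) h"
    and F: "cat_functor (base T) D F" and G: "cat_functor (base T) D G"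
    and free: "\<And>p. p \<in> Obj (base T) \<Longrightarrow> iso D (h (free_algebra p))"
    and alg: "em_algebra T (M, k)"
  shows "iso D (h (M, k))"
proof -
  interpret F: cat_functor "base T" D F by fact
  interpret G: cat_functor "base T" D G by fact
  interpret h: nat_trans "em_cat T" D "F \<circ>\<^sub>F em_forget" "G \<circ>\<^sub>F em_forget" h by fact
  let ?E = "omap (endo T)" and ?e = "amap (endo T)" and ?F = "amap F" and ?G = "amap G"
  let ?h0 = "h (M, k)" and ?h1 = "h (free_algebra M)" and ?h2 = "h (free_algebra (?E M))"
  let ?\<eta> = "munit T M" and ?\<eta>' = "munit T (?E M)" and ?\<mu> = "mult T M"
  let ?i1 = "inv_arrow D ?h1" and ?i2 = "inv_arrow D ?h2"
  note [simp] = alg[unfolded em_algebra_def in_hom_def, simplified]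
  have M: "M \<in> Obj (base T)" "?E M \<in> Obj (base T)"
    by simp_all
  have [simp]: "iso D ?h1" "iso D ?h2"
    by (simp_all add: free)
  have [simp]: "em_algebra T (free_algebra M)" "em_algebra T (free_algebra (?E M))"
    by (simp_all add: em_algebra_free)
  have [simp]: "?h0 \<in> Arr D" "Dom D ?h0 = omap F M" "Cod D ?h0 = omap G M"
    "?h1 \<in> Arr D" "Dom D ?h1 = omap F (?E M)" "Cod D ?h1 = omap G (?E M)"
    "?h2 \<in> Arr D" "Dom D ?h2 = omap F (?E (?E M))" "Cod D ?h2 = omap G (?E (?E M))"
    using h.component_arr[of "(M, k)"] h.component_dom[of "(M, k)"] h.component_cod[of "(M, k)"]
      h.component_arr[of "free_algebra M"] h.component_dom[of "free_algebra M"]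
      h.component_cod[of "free_algebra M"] h.component_arr[of "free_algebra (?E M)"]
      h.component_dom[of "free_algebra (?E M)"] h.component_cod[of "free_algebra (?E M)"]
    by (simp_all add: alg)
  have \<mu>: "?\<mu> \<cdot>\<^bsub>base T\<^esub> mult T (?E M) = ?\<mu> \<cdot>\<^bsub>base T\<^esub> ?e ?\<mu>"
    and unit_\<mu>: "?\<mu> \<cdot>\<^bsub>base T\<^esub> ?\<eta>' = Ide (base T) (?E M)"
    using mult_assoc mult_unit_left by (simp_all add: eq_nt_def)
  have nat0: "?h0 \<cdot>\<^bsub>D\<^esub> ?F k = ?G k \<cdot>\<^bsub>D\<^esub> ?h1"
    using h.natural[of "(free_algebra M, (M, k), k)"]
    by (simp add: alg em_morphism_def in_hom_def)
  have nat1: "?i1 \<cdot>\<^bsub>D\<^esub> ?G (?e k) = ?F (?e k) \<cdot>\<^bsub>D\<^esub> ?i2"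
    using h.natural[of "(free_algebra (?E M), free_algebra M, ?e k)"] mult.natural[of k]
    by (intro F.cod.inv_arrow_square) (simp_all add: em_morphism_def in_hom_def)
  have nat2: "?i1 \<cdot>\<^bsub>D\<^esub> ?G ?\<mu> = ?F ?\<mu> \<cdot>\<^bsub>D\<^esub> ?i2"
    using h.natural[of "(free_algebra (?E M), free_algebra M, ?\<mu>)"] \<mu>
    by (intro F.cod.inv_arrow_square) (simp_all add: em_morphism_def in_hom_def)
  have F_split: "?F k \<cdot>\<^bsub>D\<^esub> ?F ?\<eta> = Ide D (omap F M)"
    and G_split: "?G k \<cdot>\<^bsub>D\<^esub> ?G ?\<eta> = Ide D (omap G M)"
    and G_split': "?G ?\<mu> \<cdot>\<^bsub>D\<^esub> ?G ?\<eta>' = Ide D (omap G (?E M))"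
    by (simp_all add: unit_\<mu> flip: F.amap_comp G.amap_comp)
  have F_fork: "?F k \<cdot>\<^bsub>D\<^esub> ?F (?e k) = ?F k \<cdot>\<^bsub>D\<^esub> ?F ?\<mu>"
    by (rule F.amap_square) simp_all
  have G_nat: "?G ?\<eta> \<cdot>\<^bsub>D\<^esub> ?G k = ?G (?e k) \<cdot>\<^bsub>D\<^esub> ?G ?\<eta>'"
    by (rule G.amap_square) (use munit.natural[of k] in simp_all)
  define s where "s = ?F k \<cdot>\<^bsub>D\<^esub> ?i1 \<cdot>\<^bsub>D\<^esub> ?G ?\<eta>"
  have s [simp]: "s \<in> Arr D" "Dom D s = omap G M" "Cod D s = omap F M"
    by (simp_all add: s_def)
  have "?h0 \<cdot>\<^bsub>D\<^esub> s = ?G k \<cdot>\<^bsub>D\<^esub> ?h1 \<cdot>\<^bsub>D\<^esub> ?i1 \<cdot>\<^bsub>D\<^esub> ?G ?\<eta>"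
    unfolding s_def by (rule F.cod.cmp_reassoc[OF nat0]) simp_all
  also have "\<dots> = Ide D (omap G M)"
    by (simp add: F.cod.inv_arrow_cancel_right G_split)
  finally have right: "?h0 \<cdot>\<^bsub>D\<^esub> s = Ide D (omap G M)" .
  have "s \<cdot>\<^bsub>D\<^esub> ?h0 \<cdot>\<^bsub>D\<^esub> ?F k = ?F k \<cdot>\<^bsub>D\<^esub> ?i1 \<cdot>\<^bsub>D\<^esub> ?G ?\<eta> \<cdot>\<^bsub>D\<^esub> ?G k \<cdot>\<^bsub>D\<^esub> ?h1"
    by (simp add: s_def nat0)
  also have "?G ?\<eta> \<cdot>\<^bsub>D\<^esub> ?G k \<cdot>\<^bsub>D\<^esub> ?h1 = ?G (?e k) \<cdot>\<^bsub>D\<^esub> ?G ?\<eta>' \<cdot>\<^bsub>D\<^esub> ?h1"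
    by (rule F.cod.cmp_reassoc[OF G_nat]) simp_all
  also have "?i1 \<cdot>\<^bsub>D\<^esub> ?G (?e k) \<cdot>\<^bsub>D\<^esub> ?G ?\<eta>' \<cdot>\<^bsub>D\<^esub> ?h1
      = ?F (?e k) \<cdot>\<^bsub>D\<^esub> ?i2 \<cdot>\<^bsub>D\<^esub> ?G ?\<eta>' \<cdot>\<^bsub>D\<^esub> ?h1"
    by (rule F.cod.cmp_reassoc[OF nat1]) simp_all
  also have "?F k \<cdot>\<^bsub>D\<^esub> \<dots> = ?F k \<cdot>\<^bsub>D\<^esub> ?F ?\<mu> \<cdot>\<^bsub>D\<^esub> ?i2 \<cdot>\<^bsub>D\<^esub> ?G ?\<eta>' \<cdot>\<^bsub>D\<^esub> ?h1"
    by (rule F.cod.cmp_reassoc[OF F_fork]) simp_all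
  also have "?F ?\<mu> \<cdot>\<^bsub>D\<^esub> ?i2 \<cdot>\<^bsub>D\<^esub> ?G ?\<eta>' \<cdot>\<^bsub>D\<^esub> ?h1 = ?i1 \<cdot>\<^bsub>D\<^esub> ?G ?\<mu> \<cdot>\<^bsub>D\<^esub> ?G ?\<eta>' \<cdot>\<^bsub>D\<^esub> ?h1"
    by (rule F.cod.cmp_reassoc[OF nat2[symmetric]]) simp_all
  also have "?G ?\<mu> \<cdot>\<^bsub>D\<^esub> ?G ?\<eta>' \<cdot>\<^bsub>D\<^esub> ?h1 = Ide D (omap G (?E M)) \<cdot>\<^bsub>D\<^esub> ?h1"
    by (simp add: G_split' flip: F.cod.assoc)
  also have "?F k \<cdot>\<^bsub>D\<^esub> ?i1 \<cdot>\<^bsub>D\<^esub> \<dots> = ?F k"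
    by (simp add: F.cod.inv_arrow_left)
  finally have "s \<cdot>\<^bsub>D\<^esub> ?h0 \<cdot>\<^bsub>D\<^esub> ?F k \<cdot>\<^bsub>D\<^esub> ?F ?\<eta> = ?F k \<cdot>\<^bsub>D\<^esub> ?F ?\<eta>"
    by (simp flip: F.cod.assoc)
  then have "s \<cdot>\<^bsub>D\<^esub> ?h0 = Ide D (omap F M)"
    by (simp add: F_split)
  with right show ?thesis
    by (intro F.cod.isoI[of _ s]) simp_all
qed

end


section \<open>One-cells of adjunctions and of monads\<close>

sublocale adjunction \<subseteq> L: cat_functor "src A" "tgt A" "ladj A"
  by (rule ladj_functor)

sublocale adjunction \<subseteq> R: cat_functor "tgt A" "src A" "radj A"
  by (rule radj_functor)

sublocale adjunction \<subseteq> unit: nat_trans "src A" "src A" "1\<^sub>F" "radj A \<circ>\<^sub>F ladj A" "aunit A"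
  by (rule unit_nt)

sublocale adjunction \<subseteq> counit: nat_trans "tgt A" "tgt A" "ladj A \<circ>\<^sub>F radj A" "1\<^sub>F" "acounit A"
  by (rule counit_nt)

lemma induced_monad_simps [simp]:
  "base (induced_monad A) = src A"
  "endo (induced_monad A) = radj A \<circ>\<^sub>F ladj A"
  "mult (induced_monad A) = radj A \<rhd> (acounit A \<lhd> ladj A)"
  "munit (induced_monad A) = aunit A"
  by (simp_all add: induced_monad_def)

lemma prod_adj_simps [simp]:
  "src (A \<times>\<^sub>A B) = src A \<times>\<^sub>C src B" "tgt (A \<times>\<^sub>A B) = tgt A \<times>\<^sub>C tgt B"
  "ladj (A \<times>\<^sub>A B) = ladj A \<times>\<^sub>f ladj B" "radj (A \<times>\<^sub>A B) = radj A \<times>\<^sub>f radj B"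
  "aunit (A \<times>\<^sub>A B) = aunit A \<times>\<^sub>N aunit B" "acounit (A \<times>\<^sub>A B) = acounit A \<times>\<^sub>N acounit B"
  by (simp_all add: prod_adj_def)

lemma induced_monad_prod:
  "induced_monad A \<times>\<^sub>M induced_monad B = induced_monad (A \<times>\<^sub>A B)"
  by (simp add: prod_monad_def induced_monad_def prod_adj_def comp_functor_prod fun_eq_iff)

context adjunction
begin

lemma triangle_left_component [simp]:
  "c \<in> Obj (src A) \<Longrightarrow>
    acounit A (omap (ladj A) c) \<cdot>\<^bsub>tgt A\<^esub> amap (ladj A) (aunit A c) = Ide (tgt A) (omap (ladj A) c)"
  using triangle_left by (simp add: eq_nt_def)

lemma triangle_right_component [simp]:
  "x \<in> Obj (tgt A) \<Longrightarrow>
    amap (radj A) (acounit A x) \<cdot>\<^bsub>src A\<^esub> aunit A (omap (radj A) x) = Ide (src A) (omap (radj A) x)"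
  using triangle_right by (simp add: eq_nt_def)

lemma radj_counit_square:
  assumes "x \<in> Obj (tgt A)"
  shows "amap (radj A) (acounit A x) \<cdot>\<^bsub>src A\<^esub>
      amap (radj A) (acounit A (omap (ladj A) (omap (radj A) x)))
    = amap (radj A) (acounit A x) \<cdot>\<^bsub>src A\<^esub>
      amap (radj A) (amap (ladj A) (amap (radj A) (acounit A x)))"
  by (rule R.amap_square) (use assms counit.natural[of "acounit A x"] in simp_all)

lemma monad_induced_monad: "monad (induced_monad A)"
proof (rule monad.intro)
  show "nat_trans (base (induced_monad A)) (base (induced_monad A))
      (endo (induced_monad A) \<circ>\<^sub>F endo (induced_monad A)) (endo (induced_monad A))
      (mult (induced_monad A))"
    using nat_trans_whisker_left[OF nat_trans_whisker_right[OF counit_nt ladj_functor] radj_functor]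
    by (simp add: comp_functor_assoc)
  show "nat_trans (base (induced_monad A)) (base (induced_monad A)) 1\<^sub>F (endo (induced_monad A))
      (munit (induced_monad A))"
    by (simp add: unit_nt)
  have "amap (radj A) (acounit A (omap (ladj A) c)) \<cdot>\<^bsub>src A\<^esub>
      amap (radj A) (amap (ladj A) (aunit A c)) = Ide (src A) (omap (radj A) (omap (ladj A) c))"
    if "c \<in> Obj (src A)" for c
    using that by (simp flip: R.amap_comp)
  then show "eq_nt (base (induced_monad A))
      (vcomp (base (induced_monad A)) (mult (induced_monad A))
        (endo (induced_monad A) \<rhd> munit (induced_monad A)))
      (id_nt (base (induced_monad A)) (endo (induced_monad A)))"
    by (simp add: eq_nt_def)
qed (simp_all add: eq_nt_def cat_functor_comp[OF ladj_functor radj_functor] radj_counit_square)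

lemma em_algebra_radj:
  "x \<in> Obj (tgt A) \<Longrightarrow> em_algebra (induced_monad A) (omap (radj A) x, amap (radj A) (acounit A x))"
  by (simp add: em_algebra_def in_hom_def radj_counit_square)

end

sublocale adjR_1cell \<subseteq> J: cat_functor "src A" "src B" J
  by (rule J_functor)

sublocale adjR_1cell \<subseteq> V: cat_functor "tgt A" "tgt B" V
  by (rule V_functor)

sublocale adjR_1cell \<subseteq> lam: nat_trans "src A" "tgt B" "ladj B \<circ>\<^sub>F J" "V \<circ>\<^sub>F ladj A" lam
  by (rule lam_nt)

sublocale adjR_1cell \<subseteq>
  mate: nat_trans "tgt A" "src B" "J \<circ>\<^sub>F radj A" "radj B \<circ>\<^sub>F V" "mate A B J V lam"
  using mate_invertible by (simp add: invertible_nt_def)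

context adjR_1cell
begin

lemma iso_mate: "x \<in> Obj (tgt A) \<Longrightarrow> iso (src B) (mate A B J V lam x)"
  by (rule invertible_nt_component_iso[OF mate_invertible])

lemma mate_component:
  "mate A B J V lam x = amap (radj B) (amap V (acounit A x)) \<cdot>\<^bsub>src B\<^esub>
    amap (radj B) (lam (omap (radj A) x)) \<cdot>\<^bsub>src B\<^esub> aunit B (omap J (omap (radj A) x))"
  by (simp add: mate_def)

lemma Phi_component:
  "Phi A B J V lam c = inv_arrow (src B) (mate A B J V lam (omap (ladj A) c)) \<cdot>\<^bsub>src B\<^esub>
    amap (radj B) (lam c)"
  by (simp add: Phi_def)

lemma counit_mate:
  assumes x: "x \<in> Obj (tgt A)"
  shows "acounit B (omap V x) \<cdot>\<^bsub>tgt B\<^esub> amap (ladj B) (mate A B J V lam x)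
    = amap V (acounit A x) \<cdot>\<^bsub>tgt B\<^esub> lam (omap (radj A) x)"
proof -
  let ?r = "omap (radj A) x" and ?LB = "amap (ladj B)" and ?RB = "amap (radj B)"
  let ?v = "amap V (acounit A x)"
  let ?u = "?LB (aunit B (omap J ?r))"
  have "acounit B (omap V x) \<cdot>\<^bsub>tgt B\<^esub> ?LB (mate A B J V lam x)
      = acounit B (omap V x) \<cdot>\<^bsub>tgt B\<^esub> ?LB (?RB ?v) \<cdot>\<^bsub>tgt B\<^esub> ?LB (?RB (lam ?r)) \<cdot>\<^bsub>tgt B\<^esub> ?u"
    using x by (simp add: mate_component target.L.amap_comp)
  also have "\<dots> = ?v \<cdot>\<^bsub>tgt B\<^esub> acounit B (omap V (omap (ladj A) ?r)) \<cdot>\<^bsub>tgt B\<^esub>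
      ?LB (?RB (lam ?r)) \<cdot>\<^bsub>tgt B\<^esub> ?u"
    by (rule target.L.cod.cmp_reassoc) (use x target.counit.natural[of ?v] in simp_all)
  also have "acounit B (omap V (omap (ladj A) ?r)) \<cdot>\<^bsub>tgt B\<^esub> ?LB (?RB (lam ?r)) \<cdot>\<^bsub>tgt B\<^esub> ?u
      = lam ?r \<cdot>\<^bsub>tgt B\<^esub> acounit B (omap (ladj B) (omap J ?r)) \<cdot>\<^bsub>tgt B\<^esub> ?u"
    by (rule target.L.cod.cmp_reassoc) (use x target.counit.natural[of "lam ?r"] in simp_all)
  also have "\<dots> = lam ?r"
    using x by simp
  finally show ?thesis .
qed

lemma mate_Phi:
  "c \<in> Obj (src A) \<Longrightarrow>
    mate A B J V lam (omap (ladj A) c) \<cdot>\<^bsub>src B\<^esub> Phi A B J V lam c = amap (radj B) (lam c)"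
  by (simp add: Phi_component iso_mate target.L.dom.inv_arrow_cancel_right)

lemma nat_trans_Phi:
  "nat_trans (src A) (src B) (radj B \<circ>\<^sub>F ladj B \<circ>\<^sub>F J) (J \<circ>\<^sub>F (radj A \<circ>\<^sub>F ladj A)) (Phi A B J V lam)"
proof -
  have "nat_trans (tgt A) (src B) (radj B \<circ>\<^sub>F V) (J \<circ>\<^sub>F radj A) (inv_nt (src B) (mate A B J V lam))"
    by (rule nat_trans_inv_nt[OF mate.nat_trans_axioms iso_mate])
  from nat_trans_whisker_right[OF this source.ladj_functor]
    nat_trans_whisker_left[OF lam_nt target.radj_functor]
  show ?thesis
    unfolding Phi_def comp_functor_assoc by (intro nat_trans_vcomp)
qed

sublocale Phi: nat_trans "src A" "src B" "radj B \<circ>\<^sub>F ladj B \<circ>\<^sub>F J" "J \<circ>\<^sub>F (radj A \<circ>\<^sub>F ladj A)"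
  "Phi A B J V lam"
  by (rule nat_trans_Phi)

text \<open>Both axioms of a monad 1-cell are checked after composition with the invertible mate.\<close>

lemma Phi_unit:
  assumes c: "c \<in> Obj (src A)"
  shows "Phi A B J V lam c \<cdot>\<^bsub>src B\<^esub> aunit B (omap J c) = amap J (aunit A c)"
proof (rule target.L.dom.iso_cancel_left)
  let ?l = "omap (ladj A) c" and ?\<eta> = "aunit A c" and ?\<rho> = "mate A B J V lam"
  let ?r = "omap (radj A) ?l" and ?RV = "\<lambda>f. amap (radj B) (amap V f)"
  show "iso (src B) (?\<rho> ?l)"
    using c by (simp add: iso_mate)
  have split: "?RV (acounit A ?l) \<cdot>\<^bsub>src B\<^esub> ?RV (amap (ladj A) ?\<eta>)
      = Ide (src B) (omap (radj B) (omap V ?l))"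
    using c by (simp flip: target.R.amap_comp V.amap_comp)
  have "?\<rho> ?l \<cdot>\<^bsub>src B\<^esub> amap J ?\<eta>
      = ?RV (acounit A ?l) \<cdot>\<^bsub>src B\<^esub> amap (radj B) (lam ?r) \<cdot>\<^bsub>src B\<^esub> aunit B (omap J ?r) \<cdot>\<^bsub>src B\<^esub> amap J ?\<eta>"
    using c by (simp add: mate_component)
  also have "aunit B (omap J ?r) \<cdot>\<^bsub>src B\<^esub> amap J ?\<eta>
      = amap (radj B) (amap (ladj B) (amap J ?\<eta>)) \<cdot>\<^bsub>src B\<^esub> aunit B (omap J c)"
    using c target.unit.natural[of "amap J ?\<eta>"] by simp
  also have "amap (radj B) (lam ?r) \<cdot>\<^bsub>src B\<^esub> \<dots>
      = ?RV (amap (ladj A) ?\<eta>) \<cdot>\<^bsub>src B\<^esub> amap (radj B) (lam c) \<cdot>\<^bsub>src B\<^esub> aunit B (omap J c)"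
    by (rule target.L.dom.cmp_reassoc[OF target.R.amap_square]) (use c lam.natural[of ?\<eta>] in simp_all)
  also have "?RV (acounit A ?l) \<cdot>\<^bsub>src B\<^esub> \<dots> = amap (radj B) (lam c) \<cdot>\<^bsub>src B\<^esub> aunit B (omap J c)"
    using c split by (simp flip: target.L.dom.assoc)
  also have "\<dots> = (?\<rho> ?l \<cdot>\<^bsub>src B\<^esub> Phi A B J V lam c) \<cdot>\<^bsub>src B\<^esub> aunit B (omap J c)"
    using c by (simp only: mate_Phi)
  also have "\<dots> = ?\<rho> ?l \<cdot>\<^bsub>src B\<^esub> Phi A B J V lam c \<cdot>\<^bsub>src B\<^esub> aunit B (omap J c)"
    using c by simp
  finally show "?\<rho> ?l \<cdot>\<^bsub>src B\<^esub> Phi A B J V lam c \<cdot>\<^bsub>src B\<^esub> aunit B (omap J c)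
      = ?\<rho> ?l \<cdot>\<^bsub>src B\<^esub> amap J ?\<eta>" ..
qed (use c in simp_all)

lemma Phi_mult:
  assumes c: "c \<in> Obj (src A)"
  defines "l \<equiv> omap (ladj A) c"
  shows "Phi A B J V lam c \<cdot>\<^bsub>src B\<^esub> amap (radj B) (acounit B (omap (ladj B) (omap J c)))
    = amap J (amap (radj A) (acounit A l)) \<cdot>\<^bsub>src B\<^esub> Phi A B J V lam (omap (radj A) l) \<cdot>\<^bsub>src B\<^esub>
      amap (radj B) (amap (ladj B) (Phi A B J V lam c))"
proof (rule target.L.dom.iso_cancel_left)
  let ?\<rho> = "mate A B J V lam" and ?\<phi> = "Phi A B J V lam" and ?R = "amap (radj B)"
  let ?LB = "amap (ladj B)"
  let ?r = "omap (radj A) l"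
  have l: "l \<in> Obj (tgt A)"
    using c by (simp add: l_def)
  show "iso (src B) (?\<rho> l)"
    using l by (rule iso_mate)
  have "lam c \<cdot>\<^bsub>tgt B\<^esub> acounit B (omap (ladj B) (omap J c))
      = acounit B (omap V l) \<cdot>\<^bsub>tgt B\<^esub> ?LB (?R (lam c))"
    using c l target.counit.natural[of "lam c"] by (simp add: l_def)
  also have "\<dots> = acounit B (omap V l) \<cdot>\<^bsub>tgt B\<^esub> ?LB (?\<rho> l) \<cdot>\<^bsub>tgt B\<^esub> ?LB (?\<phi> c)"
    using c l by (simp add: l_def mate_Phi flip: target.L.amap_comp)
  also have "\<dots> = amap V (acounit A l) \<cdot>\<^bsub>tgt B\<^esub> lam ?r \<cdot>\<^bsub>tgt B\<^esub> ?LB (?\<phi> c)"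
    by (rule target.L.cod.cmp_reassoc[OF counit_mate]) (use c l in \<open>simp_all add: l_def\<close>)
  finally have adjoint: "lam c \<cdot>\<^bsub>tgt B\<^esub> acounit B (omap (ladj B) (omap J c))
      = amap V (acounit A l) \<cdot>\<^bsub>tgt B\<^esub> lam ?r \<cdot>\<^bsub>tgt B\<^esub> ?LB (?\<phi> c)" .
  have "?\<rho> l \<cdot>\<^bsub>src B\<^esub> ?\<phi> c \<cdot>\<^bsub>src B\<^esub> ?R (acounit B (omap (ladj B) (omap J c)))
      = (?\<rho> l \<cdot>\<^bsub>src B\<^esub> ?\<phi> c) \<cdot>\<^bsub>src B\<^esub> ?R (acounit B (omap (ladj B) (omap J c)))"
    using c by (simp add: l_def)
  also have "\<dots> = ?R (lam c \<cdot>\<^bsub>tgt B\<^esub> acounit B (omap (ladj B) (omap J c)))"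
    using c by (simp add: l_def mate_Phi target.R.amap_comp del: target.L.dom.assoc)
  also have "\<dots> = ?R (amap V (acounit A l)) \<cdot>\<^bsub>src B\<^esub> ?R (lam ?r) \<cdot>\<^bsub>src B\<^esub> ?R (?LB (?\<phi> c))"
    unfolding adjoint using c l by (simp add: l_def target.R.amap_comp)
  also have "?R (lam ?r) = ?\<rho> (omap (ladj A) ?r) \<cdot>\<^bsub>src B\<^esub> ?\<phi> ?r"
    using l by (simp add: mate_Phi)
  also have "?R (amap V (acounit A l)) \<cdot>\<^bsub>src B\<^esub> (?\<rho> (omap (ladj A) ?r) \<cdot>\<^bsub>src B\<^esub> ?\<phi> ?r) \<cdot>\<^bsub>src B\<^esub> ?R (?LB (?\<phi> c))
      = ?R (amap V (acounit A l)) \<cdot>\<^bsub>src B\<^esub> ?\<rho> (omap (ladj A) ?r) \<cdot>\<^bsub>src B\<^esub> ?\<phi> ?r \<cdot>\<^bsub>src B\<^esub> ?R (?LB (?\<phi> c))"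
    using c l by (simp add: l_def)
  also have "\<dots> = ?\<rho> l \<cdot>\<^bsub>src B\<^esub> amap J (amap (radj A) (acounit A l)) \<cdot>\<^bsub>src B\<^esub> ?\<phi> ?r \<cdot>\<^bsub>src B\<^esub> ?R (?LB (?\<phi> c))"
    by (rule target.L.dom.cmp_reassoc) (use c l mate.natural[of "acounit A l"] in \<open>simp_all add: l_def\<close>)
  finally show "?\<rho> l \<cdot>\<^bsub>src B\<^esub> ?\<phi> c \<cdot>\<^bsub>src B\<^esub> ?R (acounit B (omap (ladj B) (omap J c)))
      = ?\<rho> l \<cdot>\<^bsub>src B\<^esub> amap J (amap (radj A) (acounit A l)) \<cdot>\<^bsub>src B\<^esub> ?\<phi> ?r \<cdot>\<^bsub>src B\<^esub> ?R (?LB (?\<phi> c))" .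
qed (use c in \<open>simp_all add: l_def\<close>)

lemma mnd_1cell_Phi: "mnd_1cell (induced_monad A) (induced_monad B) J (Phi A B J V lam)"
proof (intro mnd_1cell.intro mnd_1cell_axioms.intro)
  show "monad (induced_monad A)" "monad (induced_monad B)"
    by (rule source.monad_induced_monad target.monad_induced_monad)+
qed (simp_all add: J_functor nat_trans_Phi eq_nt_def Phi_unit Phi_mult)

end


section \<open>Fusion transformations\<close>

lemma nat_trans_H_adj:
  fixes A :: "('o, 'a, 'p, 'b) adj"
  assumes "adjunction A" "adjunction A'" "adjR_1cell (A \<times>\<^sub>A A') B J V lam"
  shows "nat_trans (src A \<times>\<^sub>C tgt A') (tgt B)
    (ladj B \<circ>\<^sub>F J \<circ>\<^sub>F (1\<^sub>F \<times>\<^sub>f radj A')) (V \<circ>\<^sub>F (ladj A \<times>\<^sub>f 1\<^sub>F)) (H_adj A A' B V lam)"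
proof -
  interpret A: adjunction A by fact
  interpret A': adjunction A' by fact
  interpret cell: adjR_1cell "A \<times>\<^sub>A A'" B J V lam by fact
  let ?I = "(1\<^sub>F :: ('o, 'a, 'o, 'a) functr) \<times>\<^sub>f radj A'"
  have "nat_trans (src A \<times>\<^sub>C tgt A') (tgt B) (ladj B \<circ>\<^sub>F J \<circ>\<^sub>F ?I)
      (V \<circ>\<^sub>F (ladj A \<times>\<^sub>f ladj A') \<circ>\<^sub>F ?I) (lam \<lhd> ?I)"
    using cell.lam_nt
      cat_functor_prod[OF cat_functor_id[OF A.L.dom.category_axioms] A'.radj_functor]
    by (simp add: nat_trans_whisker_right)
  moreover have "nat_trans (src A \<times>\<^sub>C tgt A') (tgt B)
      (V \<circ>\<^sub>F (ladj A \<times>\<^sub>f ladj A') \<circ>\<^sub>F ?I) (V \<circ>\<^sub>F (ladj A \<times>\<^sub>f 1\<^sub>F))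
      (V \<rhd> (id_nt (tgt A) (ladj A) \<times>\<^sub>N acounit A'))"
    using nat_trans_prod[OF nat_trans_id[OF A.ladj_functor] A'.counit_nt] cell.V_functor
    by (simp add: comp_functor_assoc comp_functor_prod nat_trans_whisker_left)
  ultimately show ?thesis
    unfolding H_adj_def by (rule nat_trans_vcomp)
qed

lemma nat_trans_H_mnd:
  fixes S :: "('o, 'a) mnd" and E :: "('p, 'b) mnd"
  assumes "monad S" "monad E" "mnd_1cell (S \<times>\<^sub>M E) T J psi"
  shows "nat_trans (base S \<times>\<^sub>C em_cat E) (base T)
    (endo T \<circ>\<^sub>F J \<circ>\<^sub>F (1\<^sub>F \<times>\<^sub>f em_forget)) (J \<circ>\<^sub>F (endo S \<times>\<^sub>f em_forget)) (H_mnd S T J psi)"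
proof -
  interpret S: monad S by fact
  interpret E: monad E by fact
  let ?I = "(1\<^sub>F :: ('o, 'a, 'o, 'a) functr) \<times>\<^sub>f
    (em_forget :: ('p \<times> 'b, ('p \<times> 'b) \<times> ('p \<times> 'b) \<times> 'b, 'p, 'b) functr)"
  have psi: "nat_trans (base S \<times>\<^sub>C base E) (base T) (endo T \<circ>\<^sub>F J) (J \<circ>\<^sub>F (endo S \<times>\<^sub>f endo E)) psi"
    and J: "cat_functor (base S \<times>\<^sub>C base E) (base T) J"
    using mnd_1cell.psi_nt[OF assms(3)] mnd_1cell.B_functor[OF assms(3)]
    by (simp_all add: prod_monad_def)
  have "nat_trans (base S \<times>\<^sub>C em_cat E) (base T) (endo T \<circ>\<^sub>F J \<circ>\<^sub>F ?I)
      (J \<circ>\<^sub>F (endo S \<times>\<^sub>f endo E) \<circ>\<^sub>F ?I) (psi \<lhd> ?I)"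
    using psi cat_functor_prod[OF cat_functor_id[OF S.endo.dom.category_axioms]
        E.cat_functor_em_forget]
    by (rule nat_trans_whisker_right)
  moreover have "nat_trans (base S \<times>\<^sub>C em_cat E) (base T)
      (J \<circ>\<^sub>F (endo S \<times>\<^sub>f endo E) \<circ>\<^sub>F ?I) (J \<circ>\<^sub>F (endo S \<times>\<^sub>f em_forget))
      (J \<rhd> (id_nt (base S) (endo S) \<times>\<^sub>N snd))"
    using nat_trans_prod[OF nat_trans_id[OF S.endo_functor] E.nat_trans_em_action] J
    by (simp add: comp_functor_assoc comp_functor_prod nat_trans_whisker_left)
  moreover have "H_mnd S T J psi = vcomp (base T) (J \<rhd> (id_nt (base S) (endo S) \<times>\<^sub>N snd))
      (psi \<lhd> ?I)"
    by (auto simp: H_mnd_def fun_eq_iff)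
  ultimately show ?thesis
    by (simp add: nat_trans_vcomp)
qed

definition slice_functor :: "('o, 'a) cat \<Rightarrow> 'o \<Rightarrow> ('p, 'b, 'o \<times> 'p, 'a \<times> 'b) functr"
  where "slice_functor C c = \<lparr> omap = Pair c, amap = Pair (Ide C c) \<rparr>"

lemma slice_functor_simps [simp]:
  "omap (slice_functor C c) p = (c, p)" "amap (slice_functor C c) f = (Ide C c, f)"
  by (simp_all add: slice_functor_def)

lemma cat_functor_slice:
  assumes "category C" "category D" "c \<in> Obj C"
  shows "cat_functor D (C \<times>\<^sub>C D) (slice_functor C c)"
proof -
  interpret C: category C by fact
  interpret D: category D by fact
  show ?thesis
    by (rule cat_functorI) (auto simp: assms category_prod_cat)
qed

lemma iso_H_mnd_if_iso_free:
  fixes S :: "('o, 'a) mnd" and E :: "('p, 'b) mnd"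
  assumes "monad S" "monad E" "mnd_1cell (S \<times>\<^sub>M E) T J psi"
    and c: "c \<in> Obj (base S)"
    and free: "\<And>p. p \<in> Obj (base E) \<Longrightarrow>
      iso (base T) (H_mnd S T J psi (c, (omap (endo E) p, mult E p)))"
    and "em_algebra E (M, k)"
  shows "iso (base T) (H_mnd S T J psi (c, (M, k)))"
proof -
  interpret S: monad S by fact
  interpret E: monad E by fact
  interpret cell: mnd_1cell "S \<times>\<^sub>M E" T J psi by fact
  let ?\<sigma> = "slice_functor (base S) c"
  let ?F = "endo T \<circ>\<^sub>F J \<circ>\<^sub>F ?\<sigma>" and ?G = "J \<circ>\<^sub>F (endo S \<times>\<^sub>f 1\<^sub>F) \<circ>\<^sub>F ?\<sigma>"
  let ?\<sigma>' = "slice_functor (base S) c ::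
    ('p \<times> 'b, ('p \<times> 'b) \<times> ('p \<times> 'b) \<times> 'b, 'o \<times> ('p \<times> 'b), 'a \<times> ('p \<times> 'b) \<times> ('p \<times> 'b) \<times> 'b) functr"
  let ?h = "H_mnd S T J psi \<lhd> ?\<sigma>'"
  have J: "cat_functor (base S \<times>\<^sub>C base E) (base T) J"
    using cell.B_functor by (simp add: prod_monad_def)
  have \<sigma>: "cat_functor (base E) (base S \<times>\<^sub>C base E) ?\<sigma>"
    by (rule cat_functor_slice) (simp_all add: S.endo.dom.category_axioms E.endo.dom.category_axioms c)
  have "nat_trans (em_cat E) (base T) (endo T \<circ>\<^sub>F J \<circ>\<^sub>F (1\<^sub>F \<times>\<^sub>f em_forget) \<circ>\<^sub>F ?\<sigma>')
      (J \<circ>\<^sub>F (endo S \<times>\<^sub>f em_forget) \<circ>\<^sub>F ?\<sigma>') ?h"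
    using nat_trans_H_mnd[OF assms(1-3)]
      cat_functor_slice[OF S.endo.dom.category_axioms E.category_em_cat c]
    by (rule nat_trans_whisker_right)
  moreover have "endo T \<circ>\<^sub>F J \<circ>\<^sub>F (1\<^sub>F \<times>\<^sub>f em_forget) \<circ>\<^sub>F ?\<sigma>' = ?F \<circ>\<^sub>F em_forget"
    "J \<circ>\<^sub>F (endo S \<times>\<^sub>f em_forget) \<circ>\<^sub>F ?\<sigma>' = ?G \<circ>\<^sub>F em_forget"
    by (rule functr_eqI; simp)+
  ultimately have "nat_trans (em_cat E) (base T) (?F \<circ>\<^sub>F em_forget) (?G \<circ>\<^sub>F em_forget) ?h"
    by simp
  moreover have "cat_functor (base E) (base T) ?F"
    by (rule cat_functor_comp[OF \<sigma> cat_functor_comp[OF J cell.target.endo_functor]])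
  moreover have "cat_functor (base E) (base T) ?G"
    by (intro cat_functor_comp[OF \<sigma>] cat_functor_comp[OF _ J] cat_functor_prod S.endo_functor
        cat_functor_id E.endo.dom.category_axioms)
  ultimately have "iso (base T) (?h (M, k))"
    by (rule E.iso_component_if_iso_free) (use free assms(6) in simp_all)
  then show ?thesis
    by simp
qed

lemma H_mnd_Phi_radj:
  assumes "adjunction A" "adjunction A'" "adjR_1cell (A \<times>\<^sub>A A') B J V lam"
    and c: "c \<in> Obj (src A)" and q: "q \<in> Obj (tgt A')"
  defines "\<rho> \<equiv> mate (A \<times>\<^sub>A A') B J V lam"
  shows "H_mnd (induced_monad A) (induced_monad B) J (Phi (A \<times>\<^sub>A A') B J V lam)
      (c, (omap (radj A') q, amap (radj A') (acounit A' q)))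
    = inv_arrow (src B) (\<rho> (omap (ladj A) c, q)) \<cdot>\<^bsub>src B\<^esub> amap (radj B) (H_adj A A' B V lam (c, q))"
proof -
  interpret A: adjunction A by fact
  interpret A': adjunction A' by fact
  interpret cell: adjR_1cell "A \<times>\<^sub>A A'" B J V lam by fact
  let ?l = "omap (ladj A) c" and ?r = "omap (radj A') q"
  let ?f = "(Ide (tgt A) ?l, acounit A' q)" and ?l' = "omap (ladj A') ?r"
  have f: "?f \<in> Arr (tgt (A \<times>\<^sub>A A'))" "Dom (tgt (A \<times>\<^sub>A A')) ?f = (?l, ?l')"
    "Cod (tgt (A \<times>\<^sub>A A')) ?f = (?l, q)"
    using c q by simp_all
  have l: "(?l, q) \<in> Obj (tgt (A \<times>\<^sub>A A'))" "(?l, ?l') \<in> Obj (tgt (A \<times>\<^sub>A A'))"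
    and r: "(c, ?r) \<in> Obj (src (A \<times>\<^sub>A A'))"
    using c q by simp_all
  note iso = cell.iso_mate[OF l(1), folded \<rho>_def] cell.iso_mate[OF l(2), folded \<rho>_def]
  note types = f l r iso cell.lam.component_arr[OF r] cell.lam.component_dom[OF r]
    cell.lam.component_cod[OF r]
    cell.mate.component_dom[OF l(1), folded \<rho>_def] cell.mate.component_cod[OF l(1), folded \<rho>_def]
    cell.mate.component_dom[OF l(2), folded \<rho>_def] cell.mate.component_cod[OF l(2), folded \<rho>_def]
    cell.V.arr_amap[OF f(1)] cell.V.dom_amap[OF f(1)] cell.V.cod_amap[OF f(1)]
    cell.J.arr_amap[OF cell.source.R.arr_amap[OF f(1)]]
    cell.J.dom_amap[OF cell.source.R.arr_amap[OF f(1)]]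
    cell.J.cod_amap[OF cell.source.R.arr_amap[OF f(1)]]
  have "amap (radj B) (H_adj A A' B V lam (c, q))
      = amap (radj B) (amap V ?f) \<cdot>\<^bsub>src B\<^esub> amap (radj B) (lam (c, ?r))"
    using types by (simp add: H_adj_def cell.target.R.amap_comp)
  moreover have "inv_arrow (src B) (\<rho> (?l, q)) \<cdot>\<^bsub>src B\<^esub> amap (radj B) (amap V ?f)
      \<cdot>\<^bsub>src B\<^esub> amap (radj B) (lam (c, ?r))
    = amap J (amap (radj (A \<times>\<^sub>A A')) ?f) \<cdot>\<^bsub>src B\<^esub> inv_arrow (src B) (\<rho> (?l, ?l'))
      \<cdot>\<^bsub>src B\<^esub> amap (radj B) (lam (c, ?r))"
    by (rule cell.target.L.dom.cmp_reassoc[OF cell.target.L.dom.inv_arrow_square])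
      (use cell.mate.natural[OF f] types in \<open>simp_all add: \<rho>_def\<close>)
  ultimately show ?thesis
    using c by (simp add: H_mnd_def cell.Phi_component \<rho>_def)
qed

theorem proposition5p1p1:
  fixes A :: "('oc, 'ac, 'ox, 'ax) adj"
    and A' :: "('op, 'ap, 'oq, 'aq) adj"
    and B :: "('od, 'ad, 'oy, 'ay) adj"
    and J :: "('oc \<times> 'op, 'ac \<times> 'ap, 'od, 'ad) functr"
    and V :: "('ox \<times> 'oq, 'ax \<times> 'aq, 'oy, 'ay) functr"
    and lam :: "'oc \<times> 'op \<Rightarrow> 'ay"
  assumes "adjunction A"
    and "adjunction A'"
    and "adjunction B"
    and "adjR_1cell (A \<times>\<^sub>A A') B J V lam"
    and "reflects_isos (tgt B) (src B) (radj B)"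
  shows "left_hopf_adjR A A' B J V lam \<longleftrightarrow>
    left_hopf_mnd (induced_monad A) (induced_monad A') (induced_monad B)
      J (Phi (A \<times>\<^sub>A A') B J V lam)"
proof -
  interpret A: adjunction A by fact
  interpret A': adjunction A' by fact
  interpret cell: adjR_1cell "A \<times>\<^sub>A A'" B J V lam by fact
  let ?\<Phi> = "Phi (A \<times>\<^sub>A A') B J V lam" and ?H = "H_adj A A' B V lam"
  let ?K = "H_mnd (induced_monad A) (induced_monad B) J ?\<Phi>"
  have cell: "mnd_1cell (induced_monad A \<times>\<^sub>M induced_monad A') (induced_monad B) J ?\<Phi>"
    unfolding induced_monad_prod by (rule cell.mnd_1cell_Phi)
  note H = nat_trans_H_adj[OF assms(1,2,4)]
    and K = nat_trans_H_mnd[OF A.monad_induced_monad A'.monad_induced_monad cell]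
  interpret H: nat_trans "src A \<times>\<^sub>C tgt A'" "tgt B" "ladj B \<circ>\<^sub>F J \<circ>\<^sub>F (1\<^sub>F \<times>\<^sub>f radj A')"
    "V \<circ>\<^sub>F (ladj A \<times>\<^sub>f 1\<^sub>F)" ?H
    by (rule H)
  have component: "iso (src B) (?K (c, (omap (radj A') q, amap (radj A') (acounit A' q))))
      \<longleftrightarrow> iso (tgt B) (?H (c, q))" if c: "c \<in> Obj (src A)" and q: "q \<in> Obj (tgt A')" for c q
  proof -
    have x: "(c, q) \<in> Obj (src A \<times>\<^sub>C tgt A')" and l: "(omap (ladj A) c, q) \<in> Obj (tgt (A \<times>\<^sub>A A'))"
      using c q by simp_all
    have "iso (src B) (?K (c, (omap (radj A') q, amap (radj A') (acounit A' q))))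
        \<longleftrightarrow> iso (src B) (amap (radj B) (?H (c, q)))"
      unfolding H_mnd_Phi_radj[OF assms(1,2,4) c q]
      by (rule cell.target.L.dom.iso_cmp_inv_iff[OF cell.iso_mate[OF l]])
        (simp_all add: H.component_arr[OF x] H.component_cod[OF x] cell.mate.component_cod[OF l])
    also have "\<dots> \<longleftrightarrow> iso (tgt B) (?H (c, q))"
      using assms(5) H.component_arr[OF x] cell.target.R.iso_amap
      by (auto simp: reflects_isos_def)
    finally show ?thesis .
  qed
  have "(\<forall>x \<in> Obj (src A \<times>\<^sub>C tgt A'). iso (tgt B) (?H x)) \<longleftrightarrow>
    (\<forall>x \<in> Obj (src A \<times>\<^sub>C em_cat (induced_monad A')). iso (src B) (?K x))"
  proof (intro iffI ballI)
    fix x assume H_iso: "\<forall>x \<in> Obj (src A \<times>\<^sub>C tgt A'). iso (tgt B) (?H x)"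
      and "x \<in> Obj (src A \<times>\<^sub>C em_cat (induced_monad A'))"
    then obtain c M k where x: "x = (c, (M, k))"
      and c: "c \<in> Obj (src A)" and alg: "em_algebra (induced_monad A') (M, k)"
      by (cases x) auto
    have "iso (base (induced_monad B)) (?K (c, (M, k)))"
    proof (rule iso_H_mnd_if_iso_free[OF A.monad_induced_monad A'.monad_induced_monad cell _ _ alg])
      fix p assume "p \<in> Obj (base (induced_monad A'))"
      then show "iso (base (induced_monad B))
          (?K (c, (omap (endo (induced_monad A')) p, mult (induced_monad A') p)))"
        using component[of c "omap (ladj A') p"] H_iso c by simp
    qed (use c in simp)
    then show "iso (src B) (?K x)"
      by (simp add: x)
  next
    fix x assume "\<forall>x \<in> Obj (src A \<times>\<^sub>C em_cat (induced_monad A')). iso (src B) (?K x)"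
      and "x \<in> Obj (src A \<times>\<^sub>C tgt A')"
    then show "iso (tgt B) (?H x)"
      using component[of "fst x" "snd x"] A'.em_algebra_radj[of "snd x"] by auto
  qed
  then show ?thesis
    using assms(4) cell invertible_nt_iff[OF H] invertible_nt_iff[OF K]
    by (simp add: left_hopf_adjR_def left_hopf_mnd_def)
qed

end
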